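(* Let $\underline{\mathsf{Cyl}}=(\mathsf{Cyl},i_0,i_1,p,v,\mathsf S,r_0,r_1,s,\Gamma_{ul})$ be a cylinder in a formal category $\mathcal A$ equipped with a contraction structure $p$, an involution structure $v$ compatible with $p$, a subdivision structure $(\mathsf S,r_0,r_1,s)$ compatible with $p$, and an upper left connection structure $\Gamma_{ul}$. Let $\underline{\mathsf{coCyl}}=(\mathsf{coCyl},e_0,e_1,c)$ be a co-cylinder in $\mathcal A$ equipped with a contraction structure $c$. Suppose that $\underline{\mathsf{Cyl}}$ is left adjoint to $\underline{\mathsf{coCyl}}$, and that the adjunction between $\mathsf{Cyl}$ and $\mathsf{coCyl}$ is compatible with $p$ and $c$. Let $f:a_0\to a_1$ be an arrow of $\mathcal A$ which is a trivial fibration with respect to $\underline{\mathsf{coCyl}}$. Then there is an arrow $j:a_1\to a_0$ of $\mathcal A$ such that $f$ is a strong deformation retraction of $j$ with respect to $\underline{\mathsf{coCyl}}$.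
   Context: Formal categories. Let $\mathcal C$ be a strict 2-category with a final object $1$. For an object $\mathcal A$ of $\mathcal C$, an object of $\mathcal A$ is a 1-arrow $1\to\mathcal A$ and an arrow of $\mathcal A$ is a 2-arrow between such; composition, commutative diagrams, pushouts and pullbacks in $\mathcal A$ are those of the category $\mathrm{Hom}_{\mathcal C}(1,\mathcal A)$. For 1-arrows $F,F_0,F_1:\mathcal A\to\mathcal A$, a 2-arrow $\eta:F_0\to F_1$, an object $a$ and an arrow $f$ of $\mathcal A$: $F(a)=F\circ a$, $F(f)$ is the whiskering of $F$ and $f$, $\eta(a):F_0(a)\to F_1(a)$ is the whiskering of $\eta$ and $a$; $F\cdot\eta$, $\eta\cdot F$ are whiskerings. Standing assumption: for all objects $\mathcal A_0,\mathcal A_1$ of $\mathcal C$ and objects $a$ of $\mathcal A_0$, evaluation at $a$ sends pushout (resp. pullback) squares of $\mathrm{Hom}_{\mathcal C}(\mathcal A_0,\mathcal A_1)$ to pushout (resp. pullback) squares of $\mathcal A_1$. (For $\mathcal C$ the 2-category of categories these are ordinary categories, functors and natural transformations.) $\mathcal A$ is a fixed object of $\mathcal C$. A cylinder in $\mathcal A$ is a 1-arrow $\mathsf{Cyl}:\mathcal A\to\mathcal A$ with 2-arrows $i_0,i_1:\mathrm{id}_{\mathcal A}\to\mathsf{Cyl}$. Contraction: $p:\mathsf{Cyl}\to\mathrm{id}_{\mathcal A}$ with $pi_0=pi_1=\mathrm{id}$. Involution: $v:\mathsf{Cyl}\to\mathsf{Cyl}$ with $vi_0=i_1$, $vi_1=i_0$;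 compatible with $p$ if $pv=p$. Subdivision: a 1-arrow $\mathsf S:\mathcal A\to\mathcal A$, 2-arrows $r_0,r_1:\mathsf{Cyl}\to\mathsf S$ with $r_0i_0=r_1i_1$ a pushout square of $i_0$ and $i_1$ in $\mathrm{Hom}_{\mathcal C}(\mathcal A,\mathcal A)$, and $s:\mathsf{Cyl}\to\mathsf S$ with $si_0=r_1i_0$, $si_1=r_0i_1$; compatible with $p$ if $\overline ps=p$, where $\overline p:\mathsf S\to\mathrm{id}_{\mathcal A}$ is the unique 2-arrow with $\overline pr_0=\overline pr_1=p$. Upper left connection: $\Gamma_{ul}:\mathsf{Cyl}^2\to\mathsf{Cyl}$ with $\Gamma_{ul}(i_0\cdot\mathsf{Cyl})=\Gamma_{ul}(\mathsf{Cyl}\cdot i_0)=\mathrm{id}$, $\Gamma_{ul}(i_1\cdot\mathsf{Cyl})=\Gamma_{ul}(\mathsf{Cyl}\cdot i_1)=i_1p$. A co-cylinder in $\mathcal A$ is a 1-arrow $\mathsf{coCyl}:\mathcal A\to\mathcal A$ with 2-arrows $e_0,e_1:\mathsf{coCyl}\to\mathrm{id}_{\mathcal A}$; a contraction structure on it is $c:\mathrm{id}_{\mathcal A}\to\mathsf{coCyl}$ with $e_0c=e_1c=\mathrm{id}$. $\underline{\mathsf{Cyl}}$ is left adjoint to $\underline{\mathsf{coCyl}}$ if $\mathsf{Cyl}$ is left adjoint to $\mathsf{coCyl}$ in $\mathcal C$, with natural bijection $\mathsf{adj}:\mathrm{Hom}_{\mathcal A}(\mathsf{Cyl}(a_0),a_1)\to\mathrm{Hom}_{\mathcal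 A}(a_0,\mathsf{coCyl}(a_1))$, and $e_\epsilon(a_1)\circ\mathsf{adj}(h)=h\circ i_\epsilon(a_0)$ for $\epsilon=0,1$ and all $h$. The adjunction is compatible with $p$ and $c$ if $\mathsf{adj}(f\circ p(a_0))=c(a_1)\circ f$ for all $f:a_0\to a_1$. A homotopy from $f_0$ to $f_1$ ($f_0,f_1:a_0\to a_1$) with respect to $\underline{\mathsf{coCyl}}$ is $h:a_0\to\mathsf{coCyl}(a_1)$ with $e_0(a_1)\circ h=f_0$, $e_1(a_1)\circ h=f_1$. $f:a_0\to a_1$ is a homotopy equivalence with respect to $\underline{\mathsf{coCyl}}$ if there are $f^{-1}:a_1\to a_0$ and homotopies from $f^{-1}f$ to $\mathrm{id}(a_0)$ and from $ff^{-1}$ to $\mathrm{id}(a_1)$. Fibration with respect to $\underline{\mathsf{coCyl}}$: $f:a_1\to a_2$ such that for all $g:a_0\to a_1$, $h:a_0\to\mathsf{coCyl}(a_2)$ with $e_0(a_2)\circ h=f\circ g$ there is $k:a_0\to\mathsf{coCyl}(a_1)$ with $\mathsf{coCyl}(f)\circ k=h$, $e_0(a_1)\circ k=g$. A trivial fibration is an arrow that is both a fibration and a homotopy equivalence with respect to $\underline{\mathsf{coCyl}}$. For $j:b_0\to b_1$, an arrow $f:b_1\to b_0$ is a strong deformation retraction of $j$ with respect to $\underline{\mathsf{coCyl}}$ if $fj=\mathrm{id}(b_0)$ and there is a homotopy $h:b_1\to\mathsf{coCyl}(b_1)$ from $jf$ to $\mathrm{id}(b_1)$ with $\mathsf{coCyl}(f)\circ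 h=c(b_0)\circ f$. *)

theory Defs
  imports Main
begin

section \<open>Categories, pushouts and pullbacks\<close>

record ('o, 'a) cat =
  Ob :: "'o set"
  Ar :: "'a set"
  Dom :: "'a \<Rightarrow> 'o"
  Cod :: "'a \<Rightarrow> 'o"
  Idt :: "'o \<Rightarrow> 'a"
  Cmp :: "'a \<Rightarrow> 'a \<Rightarrow> 'a" (infixr "\<circ>\<index>" 70)

definition hom :: "('o, 'a) cat \<Rightarrow> 'o \<Rightarrow> 'o \<Rightarrow> 'a set" where
  "hom K a b = {f \<in> Ar K. Dom K f = a \<and> Cod K f = b}"

locale category =
  fixes K :: "('o, 'a) cat" (structure)
  assumes Dom_Ob: "f \<in> Ar K \<Longrightarrow> Dom K f \<in> Ob K"
    and Cod_Ob: "f \<in> Ar K \<Longrightarrow> Cod K f \<in> Ob K"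
    and Idt_hom: "a \<in> Ob K \<Longrightarrow> Idt K a \<in> hom K a a"
    and Cmp_hom: "\<lbrakk>f \<in> hom K a b; g \<in> hom K b c\<rbrakk> \<Longrightarrow> g \<circ> f \<in> hom K a c"
    and Cmp_Idt: "f \<in> hom K a b \<Longrightarrow> f \<circ> Idt K a = f"
    and Idt_Cmp: "f \<in> hom K a b \<Longrightarrow> Idt K b \<circ> f = f"
    and Cmp_assoc: "\<lbrakk>f \<in> hom K a b; g \<in> hom K b c; h \<in> hom K c d\<rbrakk>
      \<Longrightarrow> (h \<circ> g) \<circ> f = h \<circ> (g \<circ> f)"

text \<open>The square \<open>r f = t g\<close>, with \<open>f : a \<rightarrow> b\<close>, \<open>g : a \<rightarrow> c\<close>, \<open>r : b \<rightarrow> d\<close>, \<open>t : c \<rightarrow> d\<close>.\<close>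

definition is_pushout :: "('o, 'a) cat \<Rightarrow> 'a \<Rightarrow> 'a \<Rightarrow> 'a \<Rightarrow> 'a \<Rightarrow> bool" where
  "is_pushout K f g r t \<longleftrightarrow>
    (\<exists>a b c d. f \<in> hom K a b \<and> g \<in> hom K a c \<and> r \<in> hom K b d \<and> t \<in> hom K c d \<and>
      r \<circ>\<^bsub>K\<^esub> f = t \<circ>\<^bsub>K\<^esub> g \<and>
      (\<forall>x \<in> Ob K. \<forall>u \<in> hom K b x. \<forall>w \<in> hom K c x. u \<circ>\<^bsub>K\<^esub> f = w \<circ>\<^bsub>K\<^esub> g \<longrightarrow>
        (\<exists>!m. m \<in> hom K d x \<and> m \<circ>\<^bsub>K\<^esub> r = u \<and> m \<circ>\<^bsub>K\<^esub> t = w)))"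

text \<open>The square \<open>f r = g t\<close>, with \<open>f : b \<rightarrow> a\<close>, \<open>g : c \<rightarrow> a\<close>, \<open>r : d \<rightarrow> b\<close>, \<open>t : d \<rightarrow> c\<close>.\<close>

definition is_pullback :: "('o, 'a) cat \<Rightarrow> 'a \<Rightarrow> 'a \<Rightarrow> 'a \<Rightarrow> 'a \<Rightarrow> bool" where
  "is_pullback K f g r t \<longleftrightarrow>
    (\<exists>a b c d. f \<in> hom K b a \<and> g \<in> hom K c a \<and> r \<in> hom K d b \<and> t \<in> hom K d c \<and>
      f \<circ>\<^bsub>K\<^esub> r = g \<circ>\<^bsub>K\<^esub> t \<and>
      (\<forall>x \<in> Ob K. \<forall>u \<in> hom K x b. \<forall>w \<in> hom K x c. f \<circ>\<^bsub>K\<^esub> u = g \<circ>\<^bsub>K\<^esub> w \<longrightarrow>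
        (\<exists>!m. m \<in> hom K x d \<and> r \<circ>\<^bsub>K\<^esub> m = u \<and> t \<circ>\<^bsub>K\<^esub> m = w)))"


section \<open>Strict 2-categories\<close>

record ('o, 'm, 'c) two_cat =
  Obj :: "'o set"
  Arr1 :: "'m set"
  src1 :: "'m \<Rightarrow> 'o"
  trg1 :: "'m \<Rightarrow> 'o"
  Arr2 :: "'c set"
  src2 :: "'c \<Rightarrow> 'm"
  trg2 :: "'c \<Rightarrow> 'm"
  id1 :: "'o \<Rightarrow> 'm"
  comp1 :: "'m \<Rightarrow> 'm \<Rightarrow> 'm" (infixr "\<odot>\<index>" 75)
  id2 :: "'m \<Rightarrow> 'c"
  vcomp :: "'c \<Rightarrow> 'c \<Rightarrow> 'c" (infixr "\<bullet>\<index>" 70)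
  hcomp :: "'c \<Rightarrow> 'c \<Rightarrow> 'c" (infixr "\<star>\<index>" 75)

definition cat1 :: "('o, 'm, 'c) two_cat \<Rightarrow> ('o, 'm) cat" where
  "cat1 C = \<lparr>Ob = Obj C, Ar = Arr1 C, Dom = src1 C, Cod = trg1 C, Idt = id1 C, Cmp = comp1 C\<rparr>"

definition hom_cat :: "('o, 'm, 'c) two_cat \<Rightarrow> 'o \<Rightarrow> 'o \<Rightarrow> ('m, 'c) cat" where
  "hom_cat C X Y =
    \<lparr>Ob = hom (cat1 C) X Y,
     Ar = {\<alpha> \<in> Arr2 C. src2 C \<alpha> \<in> hom (cat1 C) X Y \<and> trg2 C \<alpha> \<in> hom (cat1 C) X Y},
     Dom = src2 C, Cod = trg2 C, Idt = id2 C, Cmp = vcomp C\<rparr>"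

locale strict_2_category =
  fixes C :: "('o, 'm, 'c) two_cat" (structure)
  assumes category_cat1: "category (cat1 C)"
    and category_hom_cat: "\<lbrakk>X \<in> Obj C; Y \<in> Obj C\<rbrakk> \<Longrightarrow> category (hom_cat C X Y)"
    and src2_Arr1: "\<alpha> \<in> Arr2 C \<Longrightarrow> src2 C \<alpha> \<in> Arr1 C"
    and trg2_Arr1: "\<alpha> \<in> Arr2 C \<Longrightarrow> trg2 C \<alpha> \<in> Arr1 C"
    and src1_parallel: "\<alpha> \<in> Arr2 C \<Longrightarrow> src1 C (src2 C \<alpha>) = src1 C (trg2 C \<alpha>)"
    and trg1_parallel: "\<alpha> \<in> Arr2 C \<Longrightarrow> trg1 C (src2 C \<alpha>) = trg1 C (trg2 C \<alpha>)"
    and hcomp_hom: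
      "\<lbrakk>\<alpha> \<in> hom (hom_cat C X Y) F F'; \<beta> \<in> hom (hom_cat C Y Z) G G'\<rbrakk>
        \<Longrightarrow> \<beta> \<star> \<alpha> \<in> hom (hom_cat C X Z) (G \<odot> F) (G' \<odot> F')"
    and hcomp_id2:
      "\<lbrakk>F \<in> hom (cat1 C) X Y; G \<in> hom (cat1 C) Y Z\<rbrakk> \<Longrightarrow> id2 C G \<star> id2 C F = id2 C (G \<odot> F)"
    and interchange:
      "\<lbrakk>\<alpha> \<in> hom (hom_cat C X Y) F F'; \<alpha>' \<in> hom (hom_cat C X Y) F' F'';
        \<beta> \<in> hom (hom_cat C Y Z) G G'; \<beta>' \<in> hom (hom_cat C Y Z) G' G''\<rbrakk>
        \<Longrightarrow> (\<beta>' \<bullet> \<beta>) \<star> (\<alpha>' \<bullet> \<alpha>) = (\<beta>' \<star> \<alpha>') \<bullet> (\<beta> \<star> \<alpha>)"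
    and hcomp_assoc:
      "\<lbrakk>\<alpha> \<in> Ar (hom_cat C W X); \<beta> \<in> Ar (hom_cat C X Y); \<gamma> \<in> Ar (hom_cat C Y Z)\<rbrakk>
        \<Longrightarrow> (\<gamma> \<star> \<beta>) \<star> \<alpha> = \<gamma> \<star> (\<beta> \<star> \<alpha>)"
    and hcomp_unit_left: "\<alpha> \<in> Ar (hom_cat C X Y) \<Longrightarrow> id2 C (id1 C Y) \<star> \<alpha> = \<alpha>"
    and hcomp_unit_right: "\<alpha> \<in> Ar (hom_cat C X Y) \<Longrightarrow> \<alpha> \<star> id2 C (id1 C X) = \<alpha>"

text \<open>Whiskerings. They also express evaluation: for an object \<open>a\<close> and an arrow \<open>f\<close> of a formal
  category, \<open>F(a) = F \<odot> a\<close>, \<open>F(f) = F \<rhd> f\<close> and \<open>\<eta>(a) = \<eta> \<lhd> a\<close>.\<close>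

definition whisker_left :: "('o, 'm, 'c) two_cat \<Rightarrow> 'm \<Rightarrow> 'c \<Rightarrow> 'c" (infixr "\<rhd>\<index>" 75) where
  "F \<rhd>\<^bsub>C\<^esub> \<alpha> = id2 C F \<star>\<^bsub>C\<^esub> \<alpha>"

definition whisker_right :: "('o, 'm, 'c) two_cat \<Rightarrow> 'c \<Rightarrow> 'm \<Rightarrow> 'c" (infixl "\<lhd>\<index>" 75) where
  "\<alpha> \<lhd>\<^bsub>C\<^esub> F = \<alpha> \<star>\<^bsub>C\<^esub> id2 C F"

text \<open>Final in the 2-categorical sense: every \<open>Hom(X, T)\<close> is the terminal category.\<close>

definition final_object :: "('o, 'm, 'c) two_cat \<Rightarrow> 'o \<Rightarrow> bool" where
  "final_object C T \<longleftrightarrow> T \<in> Obj C \<and>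
    (\<forall>X \<in> Obj C. (\<exists>!F. F \<in> Ob (hom_cat C X T)) \<and> (\<exists>!\<alpha>. \<alpha> \<in> Ar (hom_cat C X T)))"


section \<open>Formal categories\<close>

locale formal_category = strict_2_category C
  for C :: "('o, 'm, 'c) two_cat" (structure) +
  fixes T :: 'o and A :: 'o
  assumes final: "final_object C T"
    and A_Obj: "A \<in> Obj C"
    and eval_pushout:
      "\<lbrakk>A0 \<in> Obj C; A1 \<in> Obj C; a \<in> Ob (hom_cat C T A0);
        is_pushout (hom_cat C A0 A1) \<eta>0 \<eta>1 \<rho>0 \<rho>1\<rbrakk>
        \<Longrightarrow> is_pushout (hom_cat C T A1) (\<eta>0 \<lhd> a) (\<eta>1 \<lhd> a) (\<rho>0 \<lhd> a) (\<rho>1 \<lhd> a)"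
    and eval_pullback:
      "\<lbrakk>A0 \<in> Obj C; A1 \<in> Obj C; a \<in> Ob (hom_cat C T A0);
        is_pullback (hom_cat C A0 A1) \<eta>0 \<eta>1 \<rho>0 \<rho>1\<rbrakk>
        \<Longrightarrow> is_pullback (hom_cat C T A1) (\<eta>0 \<lhd> a) (\<eta>1 \<lhd> a) (\<rho>0 \<lhd> a) (\<rho>1 \<lhd> a)"

context
  fixes C :: "('o, 'm, 'c) two_cat" (structure) and A :: 'o
begin

subsection \<open>Cylinders and their structures\<close>

definition cylinder :: "'m \<Rightarrow> 'c \<Rightarrow> 'c \<Rightarrow> bool" where
  "cylinder Cyl i0 i1 \<longleftrightarrow>
    Cyl \<in> Ob (hom_cat C A A) \<and>
    i0 \<in> hom (hom_cat C A A) (id1 C A) Cyl \<and>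
    i1 \<in> hom (hom_cat C A A) (id1 C A) Cyl"

definition contraction :: "'m \<Rightarrow> 'c \<Rightarrow> 'c \<Rightarrow> 'c \<Rightarrow> bool" where
  "contraction Cyl i0 i1 p \<longleftrightarrow>
    p \<in> hom (hom_cat C A A) Cyl (id1 C A) \<and>
    p \<bullet> i0 = id2 C (id1 C A) \<and> p \<bullet> i1 = id2 C (id1 C A)"

definition involution :: "'m \<Rightarrow> 'c \<Rightarrow> 'c \<Rightarrow> 'c \<Rightarrow> bool" where
  "involution Cyl i0 i1 v \<longleftrightarrow>
    v \<in> hom (hom_cat C A A) Cyl Cyl \<and> v \<bullet> i0 = i1 \<and> v \<bullet> i1 = i0"

definition involution_compatible :: "'c \<Rightarrow> 'c \<Rightarrow> bool" where
  "involution_compatible p v \<longleftrightarrow> p \<bullet> v = p"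

definition subdivision :: "'m \<Rightarrow> 'c \<Rightarrow> 'c \<Rightarrow> 'm \<Rightarrow> 'c \<Rightarrow> 'c \<Rightarrow> 'c \<Rightarrow> bool" where
  "subdivision Cyl i0 i1 S r0 r1 s \<longleftrightarrow>
    S \<in> Ob (hom_cat C A A) \<and>
    r0 \<in> hom (hom_cat C A A) Cyl S \<and>
    r1 \<in> hom (hom_cat C A A) Cyl S \<and>
    is_pushout (hom_cat C A A) i0 i1 r0 r1 \<and>
    s \<in> hom (hom_cat C A A) Cyl S \<and>
    s \<bullet> i0 = r1 \<bullet> i0 \<and> s \<bullet> i1 = r0 \<bullet> i1"

definition pbar :: "'m \<Rightarrow> 'c \<Rightarrow> 'c \<Rightarrow> 'c \<Rightarrow> 'c" where
  "pbar S r0 r1 p =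
    (THE q. q \<in> hom (hom_cat C A A) S (id1 C A) \<and> q \<bullet> r0 = p \<and> q \<bullet> r1 = p)"

definition subdivision_compatible :: "'c \<Rightarrow> 'm \<Rightarrow> 'c \<Rightarrow> 'c \<Rightarrow> 'c \<Rightarrow> bool" where
  "subdivision_compatible p S r0 r1 s \<longleftrightarrow> pbar S r0 r1 p \<bullet> s = p"

definition upper_left_connection :: "'m \<Rightarrow> 'c \<Rightarrow> 'c \<Rightarrow> 'c \<Rightarrow> 'c \<Rightarrow> bool" where
  "upper_left_connection Cyl i0 i1 p \<Gamma> \<longleftrightarrow>
    \<Gamma> \<in> hom (hom_cat C A A) (Cyl \<odot> Cyl) Cyl \<and>
    \<Gamma> \<bullet> (i0 \<lhd> Cyl) = id2 C Cyl \<and>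
    \<Gamma> \<bullet> (Cyl \<rhd> i0) = id2 C Cyl \<and>
    \<Gamma> \<bullet> (i1 \<lhd> Cyl) = i1 \<bullet> p \<and>
    \<Gamma> \<bullet> (Cyl \<rhd> i1) = i1 \<bullet> p"

subsection \<open>Co-cylinders\<close>

definition cocylinder :: "'m \<Rightarrow> 'c \<Rightarrow> 'c \<Rightarrow> bool" where
  "cocylinder coCyl e0 e1 \<longleftrightarrow>
    coCyl \<in> Ob (hom_cat C A A) \<and>
    e0 \<in> hom (hom_cat C A A) coCyl (id1 C A) \<and>
    e1 \<in> hom (hom_cat C A A) coCyl (id1 C A)"

definition cocontraction :: "'m \<Rightarrow> 'c \<Rightarrow> 'c \<Rightarrow> 'c \<Rightarrow> bool" where
  "cocontraction coCyl e0 e1 c \<longleftrightarrow>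
    c \<in> hom (hom_cat C A A) (id1 C A) coCyl \<and>
    e0 \<bullet> c = id2 C (id1 C A) \<and> e1 \<bullet> c = id2 C (id1 C A)"

subsection \<open>Adjunctions\<close>

definition adjunction :: "'m \<Rightarrow> 'm \<Rightarrow> 'c \<Rightarrow> 'c \<Rightarrow> bool" where
  "adjunction L R \<eta> \<epsilon> \<longleftrightarrow>
    L \<in> Ob (hom_cat C A A) \<and> R \<in> Ob (hom_cat C A A) \<and>
    \<eta> \<in> hom (hom_cat C A A) (id1 C A) (R \<odot> L) \<and>
    \<epsilon> \<in> hom (hom_cat C A A) (L \<odot> R) (id1 C A) \<and>
    (\<epsilon> \<lhd> L) \<bullet> (L \<rhd> \<eta>) = id2 C L \<and>
    (R \<rhd> \<epsilon>) \<bullet> (\<eta> \<lhd> R) = id2 C R"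

text \<open>The bijection \<open>Hom(L(a0), a1) \<rightarrow> Hom(a0, R(a1))\<close> induced by the unit \<open>\<eta>\<close>
  (see \<open>adj_bij_betw\<close> below).\<close>

definition adj :: "'m \<Rightarrow> 'c \<Rightarrow> 'm \<Rightarrow> 'c \<Rightarrow> 'c" where
  "adj R \<eta> a0 h = (R \<rhd> h) \<bullet> (\<eta> \<lhd> a0)"

end

context
  fixes C :: "('o, 'm, 'c) two_cat" (structure) and T A :: 'o
begin

definition cyl_left_adjoint ::
  "'m \<Rightarrow> 'c \<Rightarrow> 'c \<Rightarrow> 'm \<Rightarrow> 'c \<Rightarrow> 'c \<Rightarrow> 'c \<Rightarrow> 'c \<Rightarrow> bool" where
  "cyl_left_adjoint Cyl i0 i1 coCyl e0 e1 \<eta> \<epsilon> \<longleftrightarrow>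
    adjunction C A Cyl coCyl \<eta> \<epsilon> \<and>
    (\<forall>a0 \<in> Ob (hom_cat C T A). \<forall>a1 \<in> Ob (hom_cat C T A).
      \<forall>h \<in> hom (hom_cat C T A) (Cyl \<odot> a0) a1.
        (e0 \<lhd> a1) \<bullet> adj C coCyl \<eta> a0 h = h \<bullet> (i0 \<lhd> a0) \<and>
        (e1 \<lhd> a1) \<bullet> adj C coCyl \<eta> a0 h = h \<bullet> (i1 \<lhd> a0))"

definition adjunction_compatible :: "'m \<Rightarrow> 'c \<Rightarrow> 'c \<Rightarrow> 'c \<Rightarrow> bool" where
  "adjunction_compatible coCyl \<eta> p c \<longleftrightarrow>
    (\<forall>a0 \<in> Ob (hom_cat C T A). \<forall>a1 \<in> Ob (hom_cat C T A). \<forall>f \<in> hom (hom_cat C T A) a0 a1.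
      adj C coCyl \<eta> a0 (f \<bullet> (p \<lhd> a0)) = (c \<lhd> a1) \<bullet> f)"

subsection \<open>Homotopy theory with respect to a co-cylinder\<close>

definition homotopy :: "'m \<Rightarrow> 'c \<Rightarrow> 'c \<Rightarrow> 'm \<Rightarrow> 'm \<Rightarrow> 'c \<Rightarrow> 'c \<Rightarrow> 'c \<Rightarrow> bool" where
  "homotopy coCyl e0 e1 a0 a1 f0 f1 h \<longleftrightarrow>
    f0 \<in> hom (hom_cat C T A) a0 a1 \<and>
    f1 \<in> hom (hom_cat C T A) a0 a1 \<and>
    h \<in> hom (hom_cat C T A) a0 (coCyl \<odot> a1) \<and>
    (e0 \<lhd> a1) \<bullet> h = f0 \<and> (e1 \<lhd> a1) \<bullet> h = f1"

definition homotopy_equivalence :: "'m \<Rightarrow> 'c \<Rightarrow> 'c \<Rightarrow> 'm \<Rightarrow> 'm \<Rightarrow> 'c \<Rightarrow> bool" where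
  "homotopy_equivalence coCyl e0 e1 a0 a1 f \<longleftrightarrow>
    f \<in> hom (hom_cat C T A) a0 a1 \<and>
    (\<exists>g \<in> hom (hom_cat C T A) a1 a0.
      (\<exists>h. homotopy coCyl e0 e1 a0 a0 (g \<bullet> f) (id2 C a0) h) \<and>
      (\<exists>h. homotopy coCyl e0 e1 a1 a1 (f \<bullet> g) (id2 C a1) h))"

definition fibration :: "'m \<Rightarrow> 'c \<Rightarrow> 'm \<Rightarrow> 'm \<Rightarrow> 'c \<Rightarrow> bool" where
  "fibration coCyl e0 a1 a2 f \<longleftrightarrow>
    f \<in> hom (hom_cat C T A) a1 a2 \<and>
    (\<forall>a0 \<in> Ob (hom_cat C T A).
      \<forall>g \<in> hom (hom_cat C T A) a0 a1. \<forall>h \<in> hom (hom_cat C T A) a0 (coCyl \<odot> a2).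
        (e0 \<lhd> a2) \<bullet> h = f \<bullet> g \<longrightarrow>
        (\<exists>k \<in> hom (hom_cat C T A) a0 (coCyl \<odot> a1).
          (coCyl \<rhd> f) \<bullet> k = h \<and> (e0 \<lhd> a1) \<bullet> k = g))"

definition trivial_fibration :: "'m \<Rightarrow> 'c \<Rightarrow> 'c \<Rightarrow> 'm \<Rightarrow> 'm \<Rightarrow> 'c \<Rightarrow> bool" where
  "trivial_fibration coCyl e0 e1 a0 a1 f \<longleftrightarrow>
    fibration coCyl e0 a0 a1 f \<and> homotopy_equivalence coCyl e0 e1 a0 a1 f"

definition strong_deformation_retraction ::
  "'m \<Rightarrow> 'c \<Rightarrow> 'c \<Rightarrow> 'c \<Rightarrow> 'm \<Rightarrow> 'm \<Rightarrow> 'c \<Rightarrow> 'c \<Rightarrow> bool" where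
  "strong_deformation_retraction coCyl e0 e1 c b0 b1 j f \<longleftrightarrow>
    j \<in> hom (hom_cat C T A) b0 b1 \<and>
    f \<in> hom (hom_cat C T A) b1 b0 \<and>
    f \<bullet> j = id2 C b0 \<and>
    (\<exists>h. homotopy coCyl e0 e1 b1 b1 (j \<bullet> f) (id2 C b1) h \<and>
      (coCyl \<rhd> f) \<bullet> h = (c \<lhd> b0) \<bullet> f)"

end

section \<open>The bijection induced by an adjunction\<close>

context strict_2_category
begin

abbreviation hom1 where "hom1 X Y \<equiv> hom (cat1 C) X Y"
abbreviation hom2 where "hom2 X Y \<equiv> hom (hom_cat C X Y)"

lemma hom1_Obj:
  assumes "F \<in> hom1 X Y"
  shows "X \<in> Obj C" and "Y \<in> Obj C"
  using assms category.Dom_Ob[OF category_cat1, of F] category.Cod_Ob[OF category_cat1, of F]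
  by (auto simp: hom_def cat1_def)

lemma hom2_hom1:
  assumes "\<alpha> \<in> hom2 X Y F F'"
  shows "F \<in> hom1 X Y" and "F' \<in> hom1 X Y"
  using assms by (auto simp: hom_def hom_cat_def)

lemma hom2_Ar: "\<alpha> \<in> hom2 X Y F F' \<Longrightarrow> \<alpha> \<in> Ar (hom_cat C X Y)"
  by (simp add: hom_def)

lemma comp1_hom1: "\<lbrakk>F \<in> hom1 X Y; G \<in> hom1 Y Z\<rbrakk> \<Longrightarrow> G \<odot> F \<in> hom1 X Z"
  using category.Cmp_hom[OF category_cat1, of F X Y G Z] by (simp add: cat1_def)

lemma comp1_assoc:
  "\<lbrakk>F \<in> hom1 W X; G \<in> hom1 X Y; H \<in> hom1 Y Z\<rbrakk> \<Longrightarrow> (H \<odot> G) \<odot> F = H \<odot> (G \<odot> F)"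
  using category.Cmp_assoc[OF category_cat1, of F W X G Y H Z] by (simp add: cat1_def)

lemma comp1_id1:
  assumes "F \<in> hom1 X Y"
  shows "id1 C Y \<odot> F = F" and "F \<odot> id1 C X = F"
  using category.Cmp_Idt[OF category_cat1, of F X Y] category.Idt_Cmp[OF category_cat1, of F X Y] assms
  by (simp_all add: cat1_def)

lemma id1_hom1: "X \<in> Obj C \<Longrightarrow> id1 C X \<in> hom1 X X"
  using category.Idt_hom[OF category_cat1, of X] by (simp add: cat1_def)

lemma id2_hom2:
  assumes "F \<in> hom1 X Y"
  shows "id2 C F \<in> hom2 X Y F F"
  using category.Idt_hom[OF category_hom_cat[OF hom1_Obj[OF assms]], of F] assms
  by (simp add: hom_cat_def)

lemma vcomp_hom2:
  assumes "\<alpha> \<in> hom2 X Y F G" "\<beta> \<in> hom2 X Y G H"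
  shows "\<beta> \<bullet> \<alpha> \<in> hom2 X Y F H"
  using category.Cmp_hom[OF category_hom_cat[OF hom1_Obj[OF hom2_hom1(1)[OF assms(1)]]] assms]
  by (simp add: hom_cat_def)

lemma vcomp_assoc:
  assumes "\<alpha> \<in> hom2 X Y F G" "\<beta> \<in> hom2 X Y G H" "\<gamma> \<in> hom2 X Y H K"
  shows "(\<gamma> \<bullet> \<beta>) \<bullet> \<alpha> = \<gamma> \<bullet> (\<beta> \<bullet> \<alpha>)"
  using category.Cmp_assoc[OF category_hom_cat[OF hom1_Obj[OF hom2_hom1(1)[OF assms(1)]]] assms]
  by (simp add: hom_cat_def)

lemma vcomp_id2:
  assumes "\<alpha> \<in> hom2 X Y F G"
  shows "\<alpha> \<bullet> id2 C F = \<alpha>" and "id2 C G \<bullet> \<alpha> = \<alpha>"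
  using category.Cmp_Idt[OF category_hom_cat[OF hom1_Obj[OF hom2_hom1(1)[OF assms(1)]]] assms]
    category.Idt_Cmp[OF category_hom_cat[OF hom1_Obj[OF hom2_hom1(1)[OF assms(1)]]] assms]
  by (simp_all add: hom_cat_def)

lemma whisker_left_hom2:
  "\<lbrakk>\<alpha> \<in> hom2 X Y F F'; G \<in> hom1 Y Z\<rbrakk> \<Longrightarrow> G \<rhd> \<alpha> \<in> hom2 X Z (G \<odot> F) (G \<odot> F')"
  unfolding whisker_left_def by (rule hcomp_hom[OF _ id2_hom2])

lemma whisker_right_hom2:
  "\<lbrakk>\<alpha> \<in> hom2 Y Z G G'; F \<in> hom1 X Y\<rbrakk> \<Longrightarrow> \<alpha> \<lhd> F \<in> hom2 X Z (G \<odot> F) (G' \<odot> F)"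
  unfolding whisker_right_def by (rule hcomp_hom[OF id2_hom2])

lemma whisker_left_vcomp:
  assumes "\<alpha> \<in> hom2 X Y F F'" "\<beta> \<in> hom2 X Y F' F''" "G \<in> hom1 Y Z"
  shows "G \<rhd> (\<beta> \<bullet> \<alpha>) = (G \<rhd> \<beta>) \<bullet> (G \<rhd> \<alpha>)"
  using interchange[OF assms(1,2) id2_hom2[OF assms(3)] id2_hom2[OF assms(3)]]
  by (simp add: whisker_left_def vcomp_id2[OF id2_hom2[OF assms(3)]])

lemma whisker_right_vcomp:
  assumes "\<alpha> \<in> hom2 Y Z G G'" "\<beta> \<in> hom2 Y Z G' G''" "F \<in> hom1 X Y"
  shows "(\<beta> \<bullet> \<alpha>) \<lhd> F = (\<beta> \<lhd> F) \<bullet> (\<alpha> \<lhd> F)"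
  using interchange[OF id2_hom2[OF assms(3)] id2_hom2[OF assms(3)] assms(1,2)]
  by (simp add: whisker_right_def vcomp_id2[OF id2_hom2[OF assms(3)]])

lemma whisker_left_left:
  assumes "\<alpha> \<in> hom2 W X F F'" "G \<in> hom1 X Y" "H \<in> hom1 Y Z"
  shows "H \<rhd> (G \<rhd> \<alpha>) = (H \<odot> G) \<rhd> \<alpha>"
  using hcomp_assoc[OF hom2_Ar[OF assms(1)] hom2_Ar[OF id2_hom2[OF assms(2)]]
      hom2_Ar[OF id2_hom2[OF assms(3)]]] hcomp_id2[OF assms(2,3)]
  by (simp add: whisker_left_def)

lemma whisker_right_right:
  assumes "\<alpha> \<in> hom2 Y Z H H'" "G \<in> hom1 X Y" "F \<in> hom1 W X"
  shows "(\<alpha> \<lhd> G) \<lhd> F = \<alpha> \<lhd> (G \<odot> F)"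
  using hcomp_assoc[OF hom2_Ar[OF id2_hom2[OF assms(3)]] hom2_Ar[OF id2_hom2[OF assms(2)]]
      hom2_Ar[OF assms(1)]] hcomp_id2[OF assms(3,2)]
  by (simp add: whisker_right_def)

lemma whisker_left_right:
  assumes "\<alpha> \<in> hom2 X Y G G'" "F \<in> hom1 W X" "H \<in> hom1 Y Z"
  shows "(H \<rhd> \<alpha>) \<lhd> F = H \<rhd> (\<alpha> \<lhd> F)"
  using hcomp_assoc[OF hom2_Ar[OF id2_hom2[OF assms(2)]] hom2_Ar[OF assms(1)]
      hom2_Ar[OF id2_hom2[OF assms(3)]]]
  by (simp add: whisker_left_def whisker_right_def)

lemma whisker_naturality:
  assumes "\<alpha> \<in> hom2 X Y F F'" "\<beta> \<in> hom2 Y Z G G'"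
  shows "(\<beta> \<lhd> F') \<bullet> (G \<rhd> \<alpha>) = (G' \<rhd> \<alpha>) \<bullet> (\<beta> \<lhd> F)"
  using interchange[OF assms(1) id2_hom2[OF hom2_hom1(2)[OF assms(1)]]
      id2_hom2[OF hom2_hom1(1)[OF assms(2)]] assms(2)]
    interchange[OF id2_hom2[OF hom2_hom1(1)[OF assms(1)]] assms(1) assms(2)
      id2_hom2[OF hom2_hom1(2)[OF assms(2)]]]
  by (simp add: whisker_left_def whisker_right_def vcomp_id2[OF assms(1)] vcomp_id2[OF assms(2)])

lemma whisker_left_id1: "\<alpha> \<in> hom2 X Y F F' \<Longrightarrow> id1 C Y \<rhd> \<alpha> = \<alpha>"
  unfolding whisker_left_def by (rule hcomp_unit_left[OF hom2_Ar])

lemma whisker_id2: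
  assumes "F \<in> hom1 X Y" "G \<in> hom1 Y Z"
  shows "G \<rhd> id2 C F = id2 C (G \<odot> F)" and "id2 C G \<lhd> F = id2 C (G \<odot> F)"
  using hcomp_id2[OF assms] by (simp_all add: whisker_left_def whisker_right_def)

lemma adj_hom:
  assumes adj: "adjunction C A L R \<eta> \<epsilon>" and a0: "a0 \<in> hom1 X A" and h: "h \<in> hom2 X A (L \<odot> a0) a1"
  shows "adj C R \<eta> a0 h \<in> hom2 X A a0 (R \<odot> a1)"
proof -
  have L: "L \<in> hom1 A A" and R: "R \<in> hom1 A A" and \<eta>: "\<eta> \<in> hom2 A A (id1 C A) (R \<odot> L)"
    using adj by (auto simp: adjunction_def hom_cat_def)
  have "\<eta> \<lhd> a0 \<in> hom2 X A a0 (R \<odot> (L \<odot> a0))"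
    using whisker_right_hom2[OF \<eta> a0] by (simp add: comp1_id1[OF a0] comp1_assoc[OF a0 L R])
  then show ?thesis
    unfolding adj_def by (rule vcomp_hom2[OF _ whisker_left_hom2[OF h R]])
qed

lemma adj_bij_betw:
  assumes adj: "adjunction C A L R \<eta> \<epsilon>" and a0: "a0 \<in> hom1 X A" and a1: "a1 \<in> hom1 X A"
  shows "bij_betw (adj C R \<eta> a0) (hom2 X A (L \<odot> a0) a1) (hom2 X A a0 (R \<odot> a1))"
proof -
  have L: "L \<in> hom1 A A" and R: "R \<in> hom1 A A" and \<eta>: "\<eta> \<in> hom2 A A (id1 C A) (R \<odot> L)"
    and \<epsilon>: "\<epsilon> \<in> hom2 A A (L \<odot> R) (id1 C A)"
    and t1: "(\<epsilon> \<lhd> L) \<bullet> (L \<rhd> \<eta>) = id2 C L" and t2: "(R \<rhd> \<epsilon>) \<bullet> (\<eta> \<lhd> R) = id2 C R"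
    using adj by (auto simp: adjunction_def hom_cat_def)
  have La0: "L \<odot> a0 \<in> hom1 X A" and Ra1: "R \<odot> a1 \<in> hom1 X A"
    using comp1_hom1 a0 a1 L R by auto
  have \<eta>a: "\<eta> \<lhd> a0 \<in> hom2 X A a0 (R \<odot> (L \<odot> a0))"
    using whisker_right_hom2[OF \<eta> a0] by (simp add: comp1_id1[OF a0] comp1_assoc[OF a0 L R])
  have \<epsilon>a: "\<epsilon> \<lhd> a1 \<in> hom2 X A (L \<odot> (R \<odot> a1)) a1"
    using whisker_right_hom2[OF \<epsilon> a1] by (simp add: comp1_id1[OF a1] comp1_assoc[OF a1 R L])
  let ?g = "\<lambda>k. (\<epsilon> \<lhd> a1) \<bullet> (L \<rhd> k)"
  have g_hom: "?g k \<in> hom2 X A (L \<odot> a0) a1" if k: "k \<in> hom2 X A a0 (R \<odot> a1)" for k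
    by (rule vcomp_hom2[OF whisker_left_hom2[OF k L] \<epsilon>a])
  have gf: "?g (adj C R \<eta> a0 h) = h" if h: "h \<in> hom2 X A (L \<odot> a0) a1" for h
  proof -
    have L\<eta>: "L \<rhd> (\<eta> \<lhd> a0) \<in> hom2 X A (L \<odot> a0) (L \<odot> (R \<odot> (L \<odot> a0)))"
      by (rule whisker_left_hom2[OF \<eta>a L])
    have \<epsilon>L: "\<epsilon> \<lhd> (L \<odot> a0) \<in> hom2 X A (L \<odot> (R \<odot> (L \<odot> a0))) (L \<odot> a0)"
      using whisker_right_hom2[OF \<epsilon> La0] by (simp add: comp1_id1[OF La0] comp1_assoc[OF La0 R L])
    have "?g (adj C R \<eta> a0 h) = (\<epsilon> \<lhd> a1) \<bullet> ((L \<rhd> (R \<rhd> h)) \<bullet> (L \<rhd> (\<eta> \<lhd> a0)))"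
      by (simp add: adj_def whisker_left_vcomp[OF \<eta>a whisker_left_hom2[OF h R] L])
    also have "\<dots> = ((\<epsilon> \<lhd> a1) \<bullet> (L \<rhd> (R \<rhd> h))) \<bullet> (L \<rhd> (\<eta> \<lhd> a0))"
      by (rule vcomp_assoc[OF L\<eta> whisker_left_hom2[OF whisker_left_hom2[OF h R] L] \<epsilon>a, symmetric])
    also have "(\<epsilon> \<lhd> a1) \<bullet> (L \<rhd> (R \<rhd> h)) = h \<bullet> (\<epsilon> \<lhd> (L \<odot> a0))"
      using whisker_naturality[OF h \<epsilon>]
      by (simp add: whisker_left_left[OF h R L] whisker_left_id1[OF h])
    also have "(h \<bullet> (\<epsilon> \<lhd> (L \<odot> a0))) \<bullet> (L \<rhd> (\<eta> \<lhd> a0)) = h \<bullet> ((\<epsilon> \<lhd> (L \<odot> a0)) \<bullet> (L \<rhd> (\<eta> \<lhd> a0)))"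
      by (rule vcomp_assoc[OF L\<eta> \<epsilon>L h])
    also have "(\<epsilon> \<lhd> (L \<odot> a0)) \<bullet> (L \<rhd> (\<eta> \<lhd> a0)) = ((\<epsilon> \<lhd> L) \<bullet> (L \<rhd> \<eta>)) \<lhd> a0"
    proof -
      have "L \<rhd> \<eta> \<in> hom2 A A L ((L \<odot> R) \<odot> L)"
        using whisker_left_hom2[OF \<eta> L] by (simp add: comp1_id1[OF L] comp1_assoc[OF L R L])
      from whisker_right_vcomp[OF this whisker_right_hom2[OF \<epsilon> L] a0] show ?thesis
        by (simp add: whisker_right_right[OF \<epsilon> L a0] whisker_left_right[OF \<eta> a0 L])
    qed
    also have "h \<bullet> \<dots> = h"
      by (simp add: t1 whisker_id2[OF a0 L] vcomp_id2[OF h])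
    finally show ?thesis .
  qed
  have fg: "adj C R \<eta> a0 (?g k) = k" if k: "k \<in> hom2 X A a0 (R \<odot> a1)" for k
  proof -
    have Rk: "R \<rhd> (L \<rhd> k) \<in> hom2 X A (R \<odot> (L \<odot> a0)) (R \<odot> (L \<odot> (R \<odot> a1)))"
      by (rule whisker_left_hom2[OF whisker_left_hom2[OF k L] R])
    have R\<epsilon>: "R \<rhd> (\<epsilon> \<lhd> a1) \<in> hom2 X A (R \<odot> (L \<odot> (R \<odot> a1))) (R \<odot> a1)"
      by (rule whisker_left_hom2[OF \<epsilon>a R])
    have \<eta>R: "\<eta> \<lhd> (R \<odot> a1) \<in> hom2 X A (R \<odot> a1) (R \<odot> (L \<odot> (R \<odot> a1)))"
      using whisker_right_hom2[OF \<eta> Ra1] by (simp add: comp1_id1[OF Ra1] comp1_assoc[OF Ra1 L R])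
    have "adj C R \<eta> a0 (?g k) = ((R \<rhd> (\<epsilon> \<lhd> a1)) \<bullet> (R \<rhd> (L \<rhd> k))) \<bullet> (\<eta> \<lhd> a0)"
      by (simp add: adj_def whisker_left_vcomp[OF whisker_left_hom2[OF k L] \<epsilon>a R])
    also have "\<dots> = (R \<rhd> (\<epsilon> \<lhd> a1)) \<bullet> ((R \<rhd> (L \<rhd> k)) \<bullet> (\<eta> \<lhd> a0))"
      by (rule vcomp_assoc[OF \<eta>a Rk R\<epsilon>])
    also have "(R \<rhd> (L \<rhd> k)) \<bullet> (\<eta> \<lhd> a0) = (\<eta> \<lhd> (R \<odot> a1)) \<bullet> k"
      using whisker_naturality[OF k \<eta>]
      by (simp add: whisker_left_left[OF k L R] whisker_left_id1[OF k])
    also have "(R \<rhd> (\<epsilon> \<lhd> a1)) \<bullet> ((\<eta> \<lhd> (R \<odot> a1)) \<bullet> k)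
        = ((R \<rhd> (\<epsilon> \<lhd> a1)) \<bullet> (\<eta> \<lhd> (R \<odot> a1))) \<bullet> k"
      by (rule vcomp_assoc[OF k \<eta>R R\<epsilon>, symmetric])
    also have "(R \<rhd> (\<epsilon> \<lhd> a1)) \<bullet> (\<eta> \<lhd> (R \<odot> a1)) = ((R \<rhd> \<epsilon>) \<bullet> (\<eta> \<lhd> R)) \<lhd> a1"
    proof -
      have "\<eta> \<lhd> R \<in> hom2 A A R (R \<odot> (L \<odot> R))"
        using whisker_right_hom2[OF \<eta> R] by (simp add: comp1_id1[OF R] comp1_assoc[OF R L R])
      from whisker_right_vcomp[OF this whisker_left_hom2[OF \<epsilon> R] a1] show ?thesis
        by (simp add: whisker_right_right[OF \<eta> R a1] whisker_left_right[OF \<epsilon> a1 R])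
    qed
    also have "\<dots> \<bullet> k = k"
      by (simp add: t2 whisker_id2[OF a1 R] vcomp_id2[OF k])
    finally show ?thesis .
  qed
  show ?thesis
    by (rule bij_betw_byWitness[where f' = ?g]) (use gf fg g_hom adj_hom[OF adj a0] in auto)
qed

end

end

theory Submission
  imports Defs
begin

text \<open>
  Write \<open>E\<close> and \<open>B\<close> for the source and target of the trivial fibration \<open>f\<close>. Lifting a homotopy from
  \<open>f g\<close> to \<open>id\<close> along \<open>f\<close>, starting at the homotopy inverse \<open>g\<close>, produces a section \<open>j\<close> of \<open>f\<close>
  homotopic to \<open>g\<close> (\<open>fibration_section\<close>). Since \<open>j f\<close> and \<open>id\<close> are both homotopic to \<open>g f\<close>, there is
  a homotopy \<open>l\<close> from \<open>j f\<close> to \<open>id\<close> (\<open>homotopy_zigzag\<close>), but \<open>f l\<close>, which runs from \<open>f\<close> to \<open>f\<close>, need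
  not be constant. The point is to replace \<open>l\<close> by a homotopy whose image under \<open>f\<close> is constant.

  As \<open>f j = id\<close>, the homotopy \<open>j f l\<close> runs from \<open>j f\<close> to \<open>j f\<close> and has the same image under \<open>f\<close> as
  \<open>l\<close>. Hence the reverse of \<open>j f l\<close> followed by \<open>l\<close> is a homotopy \<open>l'\<close> from \<open>j f\<close> to \<open>id\<close>, and \<open>f l'\<close>
  is a path \<open>u = f l\<close> traversed backwards and then forwards. Such a path contracts to a constant one
  with fixed ends (\<open>retraced_path_contraction\<close>). The contraction is an arrow from \<open>Cyl(E)\<close> to
  \<open>coCyl(B)\<close>, so that the fibration property lifts it to a square in \<open>E\<close> with bottom side
  \<open>l'\<close>. The other three sides of the contraction are constant at \<open>f\<close>, so the other three sides of
  the lifted square are homotopies over \<open>f\<close>; together they connect \<open>j f\<close> to \<open>id\<close>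
  (\<open>fibrewise_homotopy_of_section\<close>). The sides over the ends of \<open>l'\<close>
  may move under the lifting, but only inside the fibres.

  Homotopies over \<open>f\<close> can be reversed and concatenated because the involution and the subdivision
  are compatible with \<open>p\<close>, that is, they carry constant homotopies to constant ones. These operations
  are performed on homotopies out of the cylinder, whereas liftings and the conclusion speak of
  homotopies into the co-cylinder; the compatibility of the adjunction with \<open>p\<close> and \<open>c\<close> matches the two
  notions of constancy (\<open>fibrewise_homotopic_iff_path\<close>).
\<close>

lemma is_pushoutD:
  assumes "is_pushout K f g r t" "r \<in> hom K b d" "t \<in> hom K c d"
  shows "r \<circ>\<^bsub>K\<^esub> f = t \<circ>\<^bsub>K\<^esub> g"
    and "\<lbrakk>x \<in> Ob K; u \<in> hom K b x; w \<in> hom K c x; u \<circ>\<^bsub>K\<^esub> f = w \<circ>\<^bsub>K\<^esub> g\<rbrakk>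
      \<Longrightarrow> \<exists>!m. m \<in> hom K d x \<and> m \<circ>\<^bsub>K\<^esub> r = u \<and> m \<circ>\<^bsub>K\<^esub> t = w"
proof -
  obtain b' c' d' where homs: "r \<in> hom K b' d'" "t \<in> hom K c' d'"
    and eq: "r \<circ>\<^bsub>K\<^esub> f = t \<circ>\<^bsub>K\<^esub> g"
    and univ: "\<forall>x \<in> Ob K. \<forall>u \<in> hom K b' x. \<forall>w \<in> hom K c' x. u \<circ>\<^bsub>K\<^esub> f = w \<circ>\<^bsub>K\<^esub> g \<longrightarrow>
        (\<exists>!m. m \<in> hom K d' x \<and> m \<circ>\<^bsub>K\<^esub> r = u \<and> m \<circ>\<^bsub>K\<^esub> t = w)"
    using assms(1) unfolding is_pushout_def by blast
  have "b' = b" "c' = c" "d' = d"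
    using homs assms(2,3) by (simp_all add: hom_def)
  then show "r \<circ>\<^bsub>K\<^esub> f = t \<circ>\<^bsub>K\<^esub> g"
    and "\<lbrakk>x \<in> Ob K; u \<in> hom K b x; w \<in> hom K c x; u \<circ>\<^bsub>K\<^esub> f = w \<circ>\<^bsub>K\<^esub> g\<rbrakk>
      \<Longrightarrow> \<exists>!m. m \<in> hom K d x \<and> m \<circ>\<^bsub>K\<^esub> r = u \<and> m \<circ>\<^bsub>K\<^esub> t = w"
    using eq univ by blast+
qed

section \<open>Arrows of the formal category\<close>

text \<open>All arguments take place in the category \<open>Hom(T, A)\<close>. Composability is expressed by equations
  between sources and targets, rather than by membership in hom sets, so that the simplifier can
  discharge the side conditions of associativity without guessing intermediate objects.\<close>

context formal_category
begin

abbreviation obj where "obj a \<equiv> a \<in> hom1 T A"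
abbreviation arr where "arr x \<equiv> x \<in> Ar (hom_cat C T A)"
abbreviation arrows where "arrows \<equiv> hom2 T A"

lemma Cmp_hom_cat: "Cmp (hom_cat C X Y) = vcomp C"
  by (simp add: hom_cat_def)

lemma obj_Ob: "a \<in> Ob (hom_cat C T A) \<longleftrightarrow> obj a"
  by (simp add: hom_cat_def)

lemma arrows_iff: "x \<in> arrows a b \<longleftrightarrow> arr x \<and> src2 C x = a \<and> trg2 C x = b"
  by (auto simp: hom_def hom_cat_def)

lemma arr_arrows: "arr x \<Longrightarrow> x \<in> arrows (src2 C x) (trg2 C x)"
  by (simp add: arrows_iff)

lemma obj_src_trg [simp]:
  assumes "arr x"
  shows "obj (src2 C x)" and "obj (trg2 C x)"
  using hom2_hom1[OF arr_arrows[OF assms]] by auto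

lemma obj_comp1 [simp]: "obj a \<Longrightarrow> F \<in> hom1 A A \<Longrightarrow> obj (F \<odot> a)"
  by (rule comp1_hom1)

lemma arr_id2 [simp]:
  assumes "obj a"
  shows "arr (id2 C a)" and "src2 C (id2 C a) = a" and "trg2 C (id2 C a) = a"
  using id2_hom2[OF assms] by (auto simp: arrows_iff)

lemma arr_vcomp [simp]:
  assumes "arr x" "arr y" "src2 C y = trg2 C x"
  shows "arr (y \<bullet> x)" and "src2 C (y \<bullet> x) = src2 C x" and "trg2 C (y \<bullet> x) = trg2 C y"
  using vcomp_hom2[of x T A "src2 C x" "trg2 C x" y "trg2 C y"] assms by (auto simp: arrows_iff)

lemma comp_assoc [simp]:
  assumes "arr x" "arr y" "arr z" "src2 C y = trg2 C x" "src2 C z = trg2 C y"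
  shows "(z \<bullet> y) \<bullet> x = z \<bullet> (y \<bullet> x)"
  using vcomp_assoc[of x T A "src2 C x" "trg2 C x" y "trg2 C y" z "trg2 C z"] assms
  by (simp add: arrows_iff)

lemma comp_id2 [simp]:
  assumes "arr x"
  shows "src2 C x = a \<Longrightarrow> x \<bullet> id2 C a = x" and "trg2 C x = a \<Longrightarrow> id2 C a \<bullet> x = x"
  using vcomp_id2[OF arr_arrows[OF assms]] by auto

text \<open>The simplifier associates composites to the right; this form of an equation between
  composites applies inside such a normal form.\<close>

lemma comp_eq_comp:
  assumes "y \<bullet> x = z" "arr x" "arr y" "src2 C y = trg2 C x" "arr w" "src2 C x = trg2 C w"
  shows "y \<bullet> (x \<bullet> w) = z \<bullet> w"
  using comp_assoc[of w x y] assms by simp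

lemma arr_functor [simp]:
  assumes "F \<in> hom1 A A" "arr x"
  shows "arr (F \<rhd> x)" and "src2 C (F \<rhd> x) = F \<odot> src2 C x"
    and "trg2 C (F \<rhd> x) = F \<odot> trg2 C x"
  using whisker_left_hom2[OF arr_arrows[OF assms(2)] assms(1)] by (auto simp: arrows_iff)

lemma arr_eval:
  assumes "\<alpha> \<in> hom2 A A F G" "obj a"
  shows "arr (\<alpha> \<lhd> a)" and "src2 C (\<alpha> \<lhd> a) = F \<odot> a" and "trg2 C (\<alpha> \<lhd> a) = G \<odot> a"
  using whisker_right_hom2[OF assms] by (auto simp: arrows_iff)

lemma eval_naturality:
  assumes "\<alpha> \<in> hom2 A A F G" "arr x"
  shows "(\<alpha> \<lhd> trg2 C x) \<bullet> (F \<rhd> x) = (G \<rhd> x) \<bullet> (\<alpha> \<lhd> src2 C x)"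
  by (rule whisker_naturality[OF arr_arrows[OF assms(2)] assms(1)])

lemma eval_vcomp:
  assumes "\<alpha> \<in> hom2 A A F G" "\<beta> \<in> hom2 A A G H" "\<beta> \<bullet> \<alpha> = \<gamma>" "obj a"
  shows "(\<beta> \<lhd> a) \<bullet> (\<alpha> \<lhd> a) = \<gamma> \<lhd> a"
  using whisker_right_vcomp[OF assms(1,2,4)] assms(3) by simp

lemma functor_comp:
  assumes "F \<in> hom1 A A" "arr x" "arr y" "src2 C y = trg2 C x"
  shows "F \<rhd> (y \<bullet> x) = (F \<rhd> y) \<bullet> (F \<rhd> x)"
  using whisker_left_vcomp[of x T A "src2 C x" "trg2 C x" y "trg2 C y" F] assms
  by (simp add: arrows_iff)

end

section \<open>The structures evaluated at an object\<close>

locale adjoint_cylinder = formal_category C T A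
  for C :: "('o, 'm, 'c) two_cat" (structure) and T A :: 'o +
  fixes Cyl S coCyl :: 'm
    and i0 i1 p v r0 r1 s \<Gamma>ul e0 e1 c \<eta> \<epsilon> :: 'c
  assumes cylinder: "cylinder C A Cyl i0 i1"
    and contraction: "contraction C A Cyl i0 i1 p"
    and involution: "involution C A Cyl i0 i1 v"
    and involution_compatible: "involution_compatible C p v"
    and subdivision: "subdivision C A Cyl i0 i1 S r0 r1 s"
    and subdivision_compatible: "subdivision_compatible C A p S r0 r1 s"
    and connection: "upper_left_connection C A Cyl i0 i1 p \<Gamma>ul"
    and cocylinder: "cocylinder C A coCyl e0 e1"
    and cocontraction: "cocontraction C A coCyl e0 e1 c"
    and left_adjoint: "cyl_left_adjoint C T A Cyl i0 i1 coCyl e0 e1 \<eta> \<epsilon>"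
    and adjunction_compatible: "adjunction_compatible C T A coCyl \<eta> p c"
begin

lemma structure_1_arrows [simp]: "Cyl \<in> hom1 A A" "S \<in> hom1 A A" "coCyl \<in> hom1 A A"
  "id1 C A \<in> hom1 A A"
  using cylinder subdivision cocylinder id1_hom1[OF A_Obj]
  by (simp_all only: cylinder_def subdivision_def cocylinder_def hom_cat_def cat.simps)

lemma structure_2_arrows:
  "i0 \<in> hom2 A A (id1 C A) Cyl" "i1 \<in> hom2 A A (id1 C A) Cyl" "p \<in> hom2 A A Cyl (id1 C A)"
  "v \<in> hom2 A A Cyl Cyl" "r0 \<in> hom2 A A Cyl S" "r1 \<in> hom2 A A Cyl S" "s \<in> hom2 A A Cyl S"
  "\<Gamma>ul \<in> hom2 A A (Cyl \<odot> Cyl) Cyl"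
  "e0 \<in> hom2 A A coCyl (id1 C A)" "e1 \<in> hom2 A A coCyl (id1 C A)"
  "c \<in> hom2 A A (id1 C A) coCyl" "\<eta> \<in> hom2 A A (id1 C A) (coCyl \<odot> Cyl)"
  using cylinder contraction involution subdivision connection cocylinder cocontraction
    left_adjoint
  unfolding cylinder_def contraction_def involution_def subdivision_def upper_left_connection_def
    cocylinder_def cocontraction_def cyl_left_adjoint_def adjunction_def by blast+

lemma id1_comp [simp]: "obj a \<Longrightarrow> id1 C A \<odot> a = a"
  by (rule comp1_id1)

lemma comp1_comp1 [simp]:
  "obj a \<Longrightarrow> F \<in> hom1 A A \<Longrightarrow> G \<in> hom1 A A \<Longrightarrow> (G \<odot> F) \<odot> a = G \<odot> (F \<odot> a)"
  by (rule comp1_assoc)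

lemma id2_eval [simp]: "obj a \<Longrightarrow> F \<in> hom1 A A \<Longrightarrow> id2 C F \<lhd> a = id2 C (F \<odot> a)"
  by (rule whisker_id2)

lemmas arr_structure [simp] = structure_2_arrows[THEN arr_eval(1)]
  structure_2_arrows[THEN arr_eval(2)] structure_2_arrows[THEN arr_eval(3)]

lemma cylinder_equations [simp]:
  assumes "obj a"
  shows "(p \<lhd> a) \<bullet> (i0 \<lhd> a) = id2 C a" and "(p \<lhd> a) \<bullet> (i1 \<lhd> a) = id2 C a"
    and "(v \<lhd> a) \<bullet> (i0 \<lhd> a) = i1 \<lhd> a" and "(v \<lhd> a) \<bullet> (i1 \<lhd> a) = i0 \<lhd> a"
    and "(p \<lhd> a) \<bullet> (v \<lhd> a) = p \<lhd> a"
    and "(s \<lhd> a) \<bullet> (i0 \<lhd> a) = (r1 \<lhd> a) \<bullet> (i0 \<lhd> a)"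
    and "(s \<lhd> a) \<bullet> (i1 \<lhd> a) = (r0 \<lhd> a) \<bullet> (i1 \<lhd> a)"
proof -
  have "p \<bullet> i0 = id2 C (id1 C A)" "p \<bullet> i1 = id2 C (id1 C A)" "v \<bullet> i0 = i1" "v \<bullet> i1 = i0" "p \<bullet> v = p"
    and s: "s \<bullet> i0 = r1 \<bullet> i0" "s \<bullet> i1 = r0 \<bullet> i1"
    using contraction involution involution_compatible subdivision
    by (simp_all add: contraction_def involution_def involution_compatible_def subdivision_def)
  note this(1-5)[THEN eval_vcomp[rotated 2], OF assms]
  from this(1)[OF structure_2_arrows(1,3)] this(2)[OF structure_2_arrows(2,3)]
    this(3)[OF structure_2_arrows(1,4)] this(4)[OF structure_2_arrows(2,4)]
    this(5)[OF structure_2_arrows(4,3)]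
  show "(p \<lhd> a) \<bullet> (i0 \<lhd> a) = id2 C a" "(p \<lhd> a) \<bullet> (i1 \<lhd> a) = id2 C a"
    "(v \<lhd> a) \<bullet> (i0 \<lhd> a) = i1 \<lhd> a" "(v \<lhd> a) \<bullet> (i1 \<lhd> a) = i0 \<lhd> a" "(p \<lhd> a) \<bullet> (v \<lhd> a) = p \<lhd> a"
    using assms by simp_all
  show "(s \<lhd> a) \<bullet> (i0 \<lhd> a) = (r1 \<lhd> a) \<bullet> (i0 \<lhd> a)"
    using eval_vcomp[OF structure_2_arrows(1,7) s(1) assms]
      eval_vcomp[OF structure_2_arrows(1,6) refl assms] by simp
  show "(s \<lhd> a) \<bullet> (i1 \<lhd> a) = (r0 \<lhd> a) \<bullet> (i1 \<lhd> a)"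
    using eval_vcomp[OF structure_2_arrows(2,7) s(2) assms]
      eval_vcomp[OF structure_2_arrows(2,5) refl assms] by simp
qed

lemma connection_equations [simp]:
  assumes "obj a"
  shows "(\<Gamma>ul \<lhd> a) \<bullet> (i0 \<lhd> (Cyl \<odot> a)) = id2 C (Cyl \<odot> a)"
    and "(\<Gamma>ul \<lhd> a) \<bullet> (Cyl \<rhd> (i0 \<lhd> a)) = id2 C (Cyl \<odot> a)"
    and "(\<Gamma>ul \<lhd> a) \<bullet> (i1 \<lhd> (Cyl \<odot> a)) = (i1 \<lhd> a) \<bullet> (p \<lhd> a)"
    and "(\<Gamma>ul \<lhd> a) \<bullet> (Cyl \<rhd> (i1 \<lhd> a)) = (i1 \<lhd> a) \<bullet> (p \<lhd> a)"
proof -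
  have eqs: "\<Gamma>ul \<bullet> (i0 \<lhd> Cyl) = id2 C Cyl" "\<Gamma>ul \<bullet> (Cyl \<rhd> i0) = id2 C Cyl"
    "\<Gamma>ul \<bullet> (i1 \<lhd> Cyl) = i1 \<bullet> p" "\<Gamma>ul \<bullet> (Cyl \<rhd> i1) = i1 \<bullet> p"
    using connection by (simp_all add: upper_left_connection_def)
  have hom: "\<alpha> \<lhd> Cyl \<in> hom2 A A Cyl (Cyl \<odot> Cyl)" "Cyl \<rhd> \<alpha> \<in> hom2 A A Cyl (Cyl \<odot> Cyl)"
    if "\<alpha> \<in> hom2 A A (id1 C A) Cyl" for \<alpha>
    using whisker_right_hom2[OF that structure_1_arrows(1)]
      whisker_left_hom2[OF that structure_1_arrows(1)]
    by (simp_all add: comp1_id1[OF structure_1_arrows(1)])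
  have i1p: "(i1 \<bullet> p) \<lhd> a = (i1 \<lhd> a) \<bullet> (p \<lhd> a)"
    using eval_vcomp[OF structure_2_arrows(3,2) refl assms] by simp
  note hom0 = hom[OF structure_2_arrows(1)] and hom1 = hom[OF structure_2_arrows(2)]
  show "(\<Gamma>ul \<lhd> a) \<bullet> (i0 \<lhd> (Cyl \<odot> a)) = id2 C (Cyl \<odot> a)"
    using eval_vcomp[OF hom0(1) structure_2_arrows(8) eqs(1) assms] assms
    by (simp add: whisker_right_right[OF structure_2_arrows(1) structure_1_arrows(1) assms])
  show "(\<Gamma>ul \<lhd> a) \<bullet> (Cyl \<rhd> (i0 \<lhd> a)) = id2 C (Cyl \<odot> a)"
    using eval_vcomp[OF hom0(2) structure_2_arrows(8) eqs(2) assms] assms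
    by (simp add: whisker_left_right[OF structure_2_arrows(1) assms structure_1_arrows(1)])
  show "(\<Gamma>ul \<lhd> a) \<bullet> (i1 \<lhd> (Cyl \<odot> a)) = (i1 \<lhd> a) \<bullet> (p \<lhd> a)"
    using eval_vcomp[OF hom1(1) structure_2_arrows(8) eqs(3) assms] assms
    by (simp add: whisker_right_right[OF structure_2_arrows(2) structure_1_arrows(1) assms] i1p)
  show "(\<Gamma>ul \<lhd> a) \<bullet> (Cyl \<rhd> (i1 \<lhd> a)) = (i1 \<lhd> a) \<bullet> (p \<lhd> a)"
    using eval_vcomp[OF hom1(2) structure_2_arrows(8) eqs(4) assms] assms
    by (simp add: whisker_left_right[OF structure_2_arrows(2) assms structure_1_arrows(1)] i1p)
qed

lemma S_pushout:
  assumes "obj a"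
  shows "(r0 \<lhd> a) \<bullet> (i0 \<lhd> a) = (r1 \<lhd> a) \<bullet> (i1 \<lhd> a)"
    and "\<lbrakk>arr x; arr y; src2 C x = Cyl \<odot> a; src2 C y = Cyl \<odot> a; trg2 C y = trg2 C x;
        x \<bullet> (i0 \<lhd> a) = y \<bullet> (i1 \<lhd> a)\<rbrakk>
      \<Longrightarrow> \<exists>!z. z \<in> arrows (S \<odot> a) (trg2 C x) \<and> z \<bullet> (r0 \<lhd> a) = x \<and> z \<bullet> (r1 \<lhd> a) = y"
proof -
  have "is_pushout (hom_cat C T A) (i0 \<lhd> a) (i1 \<lhd> a) (r0 \<lhd> a) (r1 \<lhd> a)"
    using eval_pushout[OF A_Obj A_Obj, of a i0 i1 r0 r1] assms subdivision
    unfolding obj_Ob subdivision_def by blast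
  note po = is_pushoutD[OF this, of "Cyl \<odot> a" "S \<odot> a" "Cyl \<odot> a", unfolded Cmp_hom_cat]
  show "(r0 \<lhd> a) \<bullet> (i0 \<lhd> a) = (r1 \<lhd> a) \<bullet> (i1 \<lhd> a)"
    by (rule po(1)) (simp_all add: arrows_iff assms)
  show "\<exists>!z. z \<in> arrows (S \<odot> a) (trg2 C x) \<and> z \<bullet> (r0 \<lhd> a) = x \<and> z \<bullet> (r1 \<lhd> a) = y"
    if "arr x" "arr y" "src2 C x = Cyl \<odot> a" "src2 C y = Cyl \<odot> a" "trg2 C y = trg2 C x"
      "x \<bullet> (i0 \<lhd> a) = y \<bullet> (i1 \<lhd> a)"
    by (rule po(2)) (use that in \<open>simp_all add: arrows_iff obj_Ob assms\<close>)
qed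

lemma S_copair:
  assumes "obj a" "arr x" "arr y" "src2 C x = Cyl \<odot> a" "src2 C y = Cyl \<odot> a"
    "trg2 C y = trg2 C x" "x \<bullet> (i0 \<lhd> a) = y \<bullet> (i1 \<lhd> a)"
  obtains z where "arr z" "src2 C z = S \<odot> a" "trg2 C z = trg2 C x"
    "z \<bullet> (r0 \<lhd> a) = x" "z \<bullet> (r1 \<lhd> a) = y"
  using S_pushout(2)[OF assms] unfolding arrows_iff by auto

lemma S_ext:
  assumes "obj a" "arr z" "arr w" "src2 C z = S \<odot> a" "src2 C w = S \<odot> a" "trg2 C w = trg2 C z"
    and "z \<bullet> (r0 \<lhd> a) = w \<bullet> (r0 \<lhd> a)" "z \<bullet> (r1 \<lhd> a) = w \<bullet> (r1 \<lhd> a)"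
  shows "z = w"
proof -
  have "(z \<bullet> (r0 \<lhd> a)) \<bullet> (i0 \<lhd> a) = (z \<bullet> (r1 \<lhd> a)) \<bullet> (i1 \<lhd> a)"
    using assms by (simp add: S_pushout(1))
  from S_pushout(2)[OF assms(1) _ _ _ _ _ this] assms show ?thesis
    by (auto simp: arrows_iff)
qed

text \<open>The evaluation at \<open>a\<close> of the 2-arrow \<open>pbar\<close> is all that later arguments need of it: it turns
  the compatibility of the subdivision with \<open>p\<close> into a statement about arrows out of \<open>S(a)\<close>.\<close>

lemma S_contraction:
  assumes "obj a"
  obtains q where "arr q" "src2 C q = S \<odot> a" "trg2 C q = a"
    "q \<bullet> (r0 \<lhd> a) = p \<lhd> a" "q \<bullet> (r1 \<lhd> a) = p \<lhd> a" "q \<bullet> (s \<lhd> a) = p \<lhd> a"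
proof -
  let ?q = "pbar C A S r0 r1 p"
  have "is_pushout (hom_cat C A A) i0 i1 r0 r1"
    using subdivision by (simp add: subdivision_def)
  moreover have "id1 C A \<in> Ob (hom_cat C A A)"
    using structure_1_arrows(4) by (simp only: hom_cat_def cat.simps)
  moreover have "p \<bullet> i0 = p \<bullet> i1"
    using contraction by (simp add: contraction_def)
  ultimately have "\<exists>!q. q \<in> hom2 A A S (id1 C A) \<and> q \<bullet> r0 = p \<and> q \<bullet> r1 = p"
    using is_pushoutD(2)[of "hom_cat C A A" i0 i1 r0 r1 Cyl S Cyl "id1 C A" p p, unfolded Cmp_hom_cat]
      structure_2_arrows(3,5,6) by simp
  from theI'[OF this] have q: "?q \<in> hom2 A A S (id1 C A)" "?q \<bullet> r0 = p" "?q \<bullet> r1 = p"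
    by (simp_all add: pbar_def)
  have "?q \<bullet> s = p"
    using subdivision_compatible by (simp add: subdivision_compatible_def)
  then show thesis
    using that[of "?q \<lhd> a"] arr_eval[OF q(1) assms] assms
      eval_vcomp[OF structure_2_arrows(5) q(1,2) assms]
      eval_vcomp[OF structure_2_arrows(6) q(1,3) assms]
      eval_vcomp[OF structure_2_arrows(7) q(1) _ assms] by simp
qed

lemma evaluation_naturality:
  assumes "arr f"
  shows "(e0 \<lhd> trg2 C f) \<bullet> (coCyl \<rhd> f) = f \<bullet> (e0 \<lhd> src2 C f)"
    and "(e1 \<lhd> trg2 C f) \<bullet> (coCyl \<rhd> f) = f \<bullet> (e1 \<lhd> src2 C f)"
  using eval_naturality[OF structure_2_arrows(9) assms]
    eval_naturality[OF structure_2_arrows(10) assms] whisker_left_id1[OF arr_arrows[OF assms]]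
  by simp_all

section \<open>Transposition of homotopies\<close>

abbreviation tr where "tr \<equiv> adj C coCyl \<eta>"

lemma arr_tr [simp]:
  assumes "obj a" "arr h" "src2 C h = Cyl \<odot> a"
  shows "arr (tr a h)" and "src2 C (tr a h) = a" and "trg2 C (tr a h) = coCyl \<odot> trg2 C h"
  using assms by (simp_all add: adj_def)

lemma tr_postcomp:
  assumes "obj a" "arr h" "src2 C h = Cyl \<odot> a" "arr f" "src2 C f = trg2 C h"
  shows "tr a (f \<bullet> h) = (coCyl \<rhd> f) \<bullet> tr a h"
  using assms by (simp add: adj_def functor_comp)

text \<open>With \<open>x = i0(a)\<close> or \<open>x = i1(a)\<close>, this relates the restriction of a transpose to an end of its
  remaining coordinate with the values of the connection on \<open>Cyl(i0(a))\<close> and \<open>Cyl(i1(a))\<close>.\<close>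

lemma tr_precomp:
  assumes "arr h" "arr x" "src2 C h = Cyl \<odot> trg2 C x"
  shows "tr (trg2 C x) h \<bullet> x = tr (src2 C x) (h \<bullet> (Cyl \<rhd> x))"
proof -
  have "(\<eta> \<lhd> trg2 C x) \<bullet> x = (coCyl \<rhd> (Cyl \<rhd> x)) \<bullet> (\<eta> \<lhd> src2 C x)"
    using eval_naturality[OF structure_2_arrows(12) assms(2)] assms(2)
    by (simp add: whisker_left_id1[OF arr_arrows]
        whisker_left_left[OF arr_arrows structure_1_arrows(1,3)])
  then show ?thesis
    using assms by (simp add: adj_def functor_comp)
qed

lemma ends_tr:
  assumes "obj a" "arr h" "src2 C h = Cyl \<odot> a"
  shows "(e0 \<lhd> trg2 C h) \<bullet> tr a h = h \<bullet> (i0 \<lhd> a)"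
    and "(e1 \<lhd> trg2 C h) \<bullet> tr a h = h \<bullet> (i1 \<lhd> a)"
  using left_adjoint assms by (auto simp: cyl_left_adjoint_def obj_Ob arrows_iff)

lemma tr_constant:
  assumes "arr f"
  shows "tr (src2 C f) (f \<bullet> (p \<lhd> src2 C f)) = (c \<lhd> trg2 C f) \<bullet> f"
  using adjunction_compatible assms
  by (auto simp: adjunction_compatible_def obj_Ob arrows_iff)

lemma bij_tr:
  assumes "obj a" "obj b"
  shows "bij_betw (tr a) (arrows (Cyl \<odot> a) b) (arrows a (coCyl \<odot> b))"
  using left_adjoint adj_bij_betw assms unfolding cyl_left_adjoint_def by blast

lemma tr_surj:
  assumes "arr k" "obj b" "trg2 C k = coCyl \<odot> b"
  obtains h where "arr h" "src2 C h = Cyl \<odot> src2 C k" "trg2 C h = b" "tr (src2 C k) h = k"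
proof -
  have "k \<in> tr (src2 C k) ` arrows (Cyl \<odot> src2 C k) b"
    using bij_tr[of "src2 C k" b] assms by (simp add: bij_betw_def arrows_iff)
  then show thesis
    using that by (auto simp: arrows_iff)
qed

lemma tr_inj:
  assumes "obj a" "arr x" "arr y" "src2 C x = Cyl \<odot> a" "src2 C y = Cyl \<odot> a"
    "trg2 C x = trg2 C y" "tr a x = tr a y"
  shows "x = y"
  using bij_tr[of a "trg2 C y"] assms by (auto simp: bij_betw_def arrows_iff dest: inj_onD)

section \<open>Reversal and concatenation of homotopies\<close>

text \<open>The concatenation of \<open>x\<close> and \<open>y\<close> is \<open>z \<bullet> (s \<lhd> a)\<close>. The gluing \<open>z\<close> itself is kept accessible
  because arrows out of \<open>S(a)\<close>, unlike homotopies, can be compared on the two halves.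
  The subdivision runs through \<open>r1\<close> first, hence \<open>x\<close> sits on \<open>r1\<close>.\<close>

lemma S_concatenation:
  assumes "obj a" "arr x" "arr y" "src2 C x = Cyl \<odot> a" "src2 C y = Cyl \<odot> a"
    "trg2 C y = trg2 C x" "x \<bullet> (i1 \<lhd> a) = y \<bullet> (i0 \<lhd> a)"
  obtains z where "arr z" "src2 C z = S \<odot> a" "trg2 C z = trg2 C x"
    "z \<bullet> (r0 \<lhd> a) = y" "z \<bullet> (r1 \<lhd> a) = x"
    "z \<bullet> (s \<lhd> a) \<bullet> (i0 \<lhd> a) = x \<bullet> (i0 \<lhd> a)" "z \<bullet> (s \<lhd> a) \<bullet> (i1 \<lhd> a) = y \<bullet> (i1 \<lhd> a)"
proof -
  obtain z where z: "arr z" "src2 C z = S \<odot> a" "trg2 C z = trg2 C x"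
    "z \<bullet> (r0 \<lhd> a) = y" "z \<bullet> (r1 \<lhd> a) = x"
    using S_copair[of a y x] assms by (metis (no_types))
  show thesis
    using that[OF z] z(1-3) assms(1) comp_eq_comp[OF z(4), of "i1 \<lhd> a"]
      comp_eq_comp[OF z(5), of "i0 \<lhd> a"] by simp
qed

text \<open>Both \<open>z\<close> and \<open>g\<close> after the contraction of \<open>S\<close> restrict to the constant homotopy on each half,
  so they agree; the compatibility of \<open>s\<close> with \<open>p\<close> then applies.\<close>

lemma concatenation_constant:
  assumes "arr z" "src2 C z = S \<odot> src2 C g" "arr g" "trg2 C g = trg2 C z"
    and "z \<bullet> (r0 \<lhd> src2 C g) = g \<bullet> (p \<lhd> src2 C g)" "z \<bullet> (r1 \<lhd> src2 C g) = g \<bullet> (p \<lhd> src2 C g)"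
  shows "z \<bullet> (s \<lhd> src2 C g) = g \<bullet> (p \<lhd> src2 C g)"
proof -
  obtain q where q: "arr q" "src2 C q = S \<odot> src2 C g" "trg2 C q = src2 C g"
    "q \<bullet> (r0 \<lhd> src2 C g) = p \<lhd> src2 C g" "q \<bullet> (r1 \<lhd> src2 C g) = p \<lhd> src2 C g"
    "q \<bullet> (s \<lhd> src2 C g) = p \<lhd> src2 C g"
    using S_contraction[of "src2 C g"] assms(3) by auto
  have "z = g \<bullet> q"
    by (rule S_ext[of "src2 C g"]) (use assms q in simp_all)
  then show ?thesis
    using assms q by simp
qed

text \<open>Here \<open>g0\<close> and \<open>g1\<close> are liftings of \<open>q\<close> along \<open>f\<close>, and the homotopy between them lies over the
  constant homotopy at \<open>q\<close>.\<close>

definition fibrewise_homotopic where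
  "fibrewise_homotopic f q g0 g1 \<longleftrightarrow>
    (\<exists>x. arr x \<and> src2 C x = Cyl \<odot> src2 C q \<and> trg2 C x = src2 C f \<and>
      x \<bullet> (i0 \<lhd> src2 C q) = g0 \<and> x \<bullet> (i1 \<lhd> src2 C q) = g1 \<and> f \<bullet> x = q \<bullet> (p \<lhd> src2 C q))"

lemma fibrewise_homotopic_sym:
  assumes "arr f" "arr q" "fibrewise_homotopic f q g0 g1"
  shows "fibrewise_homotopic f q g1 g0"
proof -
  obtain x where x: "arr x" "src2 C x = Cyl \<odot> src2 C q" "trg2 C x = src2 C f"
      "x \<bullet> (i0 \<lhd> src2 C q) = g0" "x \<bullet> (i1 \<lhd> src2 C q) = g1" "f \<bullet> x = q \<bullet> (p \<lhd> src2 C q)"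
    using assms(3) unfolding fibrewise_homotopic_def by blast
  show ?thesis
    unfolding fibrewise_homotopic_def
    by (rule exI[of _ "x \<bullet> (v \<lhd> src2 C q)"])
      (use assms(1,2) x comp_eq_comp[OF x(6), of "v \<lhd> src2 C q"] in simp)
qed

lemma fibrewise_homotopic_trans:
  assumes "arr f" "arr q" "trg2 C q = trg2 C f"
    and "fibrewise_homotopic f q g0 g1" "fibrewise_homotopic f q g1 g2"
  shows "fibrewise_homotopic f q g0 g2"
proof -
  let ?a = "src2 C q"
  obtain x where x: "arr x" "src2 C x = Cyl \<odot> ?a" "trg2 C x = src2 C f"
      "x \<bullet> (i0 \<lhd> ?a) = g0" "x \<bullet> (i1 \<lhd> ?a) = g1" "f \<bullet> x = q \<bullet> (p \<lhd> ?a)"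
    using assms(4) unfolding fibrewise_homotopic_def by blast
  obtain y where y: "arr y" "src2 C y = Cyl \<odot> ?a" "trg2 C y = src2 C f"
      "y \<bullet> (i0 \<lhd> ?a) = g1" "y \<bullet> (i1 \<lhd> ?a) = g2" "f \<bullet> y = q \<bullet> (p \<lhd> ?a)"
    using assms(5) unfolding fibrewise_homotopic_def by blast
  obtain z where z: "arr z" "src2 C z = S \<odot> ?a" "trg2 C z = src2 C f"
    "z \<bullet> (r0 \<lhd> ?a) = y" "z \<bullet> (r1 \<lhd> ?a) = x"
    "z \<bullet> (s \<lhd> ?a) \<bullet> (i0 \<lhd> ?a) = g0" "z \<bullet> (s \<lhd> ?a) \<bullet> (i1 \<lhd> ?a) = g2"
    by (rule S_concatenation[of ?a x y]) (use assms(2) x y in simp_all)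
  have "(f \<bullet> z) \<bullet> (s \<lhd> ?a) = q \<bullet> (p \<lhd> ?a)"
    by (rule concatenation_constant) (use assms(1-3) x(6) y(6) z in simp_all)
  then show ?thesis
    unfolding fibrewise_homotopic_def using assms(1,2) z
    by (intro exI[of _ "z \<bullet> (s \<lhd> ?a)"]) simp
qed

text \<open>Transposition is injective, commutes with composition with \<open>f\<close> and takes constant homotopies
  to constant paths; therefore a homotopy lies over the constant one exactly if its transpose lies
  over the constant path. This gives the condition in the definition of a strong deformation
  retraction.\<close>

lemma fibrewise_homotopic_iff_path:
  assumes "arr f" "arr q" "trg2 C q = trg2 C f"
  shows "fibrewise_homotopic f q g0 g1 \<longleftrightarrow>
    (\<exists>k. arr k \<and> src2 C k = src2 C q \<and> trg2 C k = coCyl \<odot> src2 C f \<and>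
      (e0 \<lhd> src2 C f) \<bullet> k = g0 \<and> (e1 \<lhd> src2 C f) \<bullet> k = g1 \<and>
      (coCyl \<rhd> f) \<bullet> k = (c \<lhd> trg2 C f) \<bullet> q)"
    (is "_ \<longleftrightarrow> (\<exists>k. ?path k)")
proof -
  let ?a = "src2 C q"
  have over: "f \<bullet> x = q \<bullet> (p \<lhd> ?a) \<longleftrightarrow> (coCyl \<rhd> f) \<bullet> tr ?a x = (c \<lhd> trg2 C f) \<bullet> q"
    if x: "arr x" "src2 C x = Cyl \<odot> ?a" "trg2 C x = src2 C f" for x
  proof -
    have "f \<bullet> x = q \<bullet> (p \<lhd> ?a) \<longleftrightarrow> tr ?a (f \<bullet> x) = tr ?a (q \<bullet> (p \<lhd> ?a))"
      using tr_inj[of ?a "f \<bullet> x" "q \<bullet> (p \<lhd> ?a)"] assms x by auto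
    then show ?thesis
      using tr_postcomp[of ?a x f] tr_constant[of q] assms x by simp
  qed
  show ?thesis
  proof
    assume "fibrewise_homotopic f q g0 g1"
    then obtain x where "arr x" "src2 C x = Cyl \<odot> ?a" "trg2 C x = src2 C f"
      "x \<bullet> (i0 \<lhd> ?a) = g0" "x \<bullet> (i1 \<lhd> ?a) = g1" "f \<bullet> x = q \<bullet> (p \<lhd> ?a)"
      unfolding fibrewise_homotopic_def by blast
    then have "?path (tr ?a x)"
      using over[of x] ends_tr[of ?a x] assms(2) by simp
    then show "\<exists>k. ?path k"
      by (rule exI[of ?path])
  next
    assume "\<exists>k. ?path k"
    then obtain k where k: "?path k" ..
    obtain x where x: "arr x" "src2 C x = Cyl \<odot> ?a" "trg2 C x = src2 C f" "tr ?a x = k"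
      using tr_surj[of k "src2 C f"] k obj_src_trg(1)[OF assms(1)] by auto
    have "x \<bullet> (i0 \<lhd> ?a) = g0" "x \<bullet> (i1 \<lhd> ?a) = g1"
      using ends_tr[of ?a x] k x assms(2) by simp_all
    moreover have "f \<bullet> x = q \<bullet> (p \<lhd> ?a)"
      using over[of x] k x by simp
    ultimately show "fibrewise_homotopic f q g0 g1"
      unfolding fibrewise_homotopic_def using x by blast
  qed
qed

section \<open>Contracting a path followed by its reverse\<close>

text \<open>The homotopy \<open>z \<bullet> (s \<lhd> a)\<close> is the reverse of \<open>u\<close> followed by \<open>u\<close>. Viewing the connection as a
  maximum, \<open>u (max t \<tau>)\<close> deforms \<open>u\<close> to the constant path at its end \<open>y\<close>, keeping the end at
  \<open>t = 1\<close> fixed. Doing this simultaneously on both halves is consistent at the junction \<open>t = 0\<close> and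
  keeps the outer ends, where \<open>t = 1\<close>, at \<open>y\<close>. Transposing the deformation parameter \<open>\<tau>\<close>
  first makes the deformation a path in \<open>coCyl\<close> depending on \<open>t\<close>, so that the two halves are
  glued by the pushout at \<open>a\<close> itself, and the result has the form to which the lifting property
  applies.\<close>

lemma retraced_path_contraction:
  assumes a: "obj a" and u: "arr u" "src2 C u = Cyl \<odot> a"
    and z: "arr z" "src2 C z = S \<odot> a" "trg2 C z = trg2 C u"
      "z \<bullet> (r0 \<lhd> a) = u" "z \<bullet> (r1 \<lhd> a) = u \<bullet> (v \<lhd> a)"
    and y: "y = u \<bullet> (i1 \<lhd> a)"
  obtains h where "arr h" "src2 C h = Cyl \<odot> a" "trg2 C h = coCyl \<odot> trg2 C u"
    "(e0 \<lhd> trg2 C u) \<bullet> h = z \<bullet> (s \<lhd> a)" "(e1 \<lhd> trg2 C u) \<bullet> h = y \<bullet> (p \<lhd> a)"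
    "h \<bullet> (i0 \<lhd> a) = (c \<lhd> trg2 C u) \<bullet> y" "h \<bullet> (i1 \<lhd> a) = (c \<lhd> trg2 C u) \<bullet> y"
proof -
  let ?b = "trg2 C u"
  \<comment> \<open>The transposed coordinate of \<open>Cyl(Cyl(a))\<close> is the outer one; it is the parameter \<open>\<tau>\<close>.\<close>
  define G where "G = tr (Cyl \<odot> a) (u \<bullet> (\<Gamma>ul \<lhd> a))"
  have G: "arr G" "src2 C G = Cyl \<odot> a" "trg2 C G = coCyl \<odot> ?b"
    using a u by (simp_all add: G_def)
  have yp: "u \<bullet> (i1 \<lhd> a) \<bullet> (p \<lhd> a) = y \<bullet> (p \<lhd> a)"
    using a u by (simp add: y)
  have y_arr: "arr y" "src2 C y = a" "trg2 C y = ?b"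
    using a u by (simp_all add: y)
  have G_start: "G \<bullet> (i0 \<lhd> a) = tr a u"
    using tr_precomp[of "u \<bullet> (\<Gamma>ul \<lhd> a)" "i0 \<lhd> a"] a u by (simp add: G_def)
  have G_end: "G \<bullet> (i1 \<lhd> a) = (c \<lhd> ?b) \<bullet> y"
    using tr_precomp[of "u \<bullet> (\<Gamma>ul \<lhd> a)" "i1 \<lhd> a"] tr_constant[of y] a u y_arr
    by (simp add: G_def yp)
  have e0G: "(e0 \<lhd> ?b) \<bullet> G = u"
    using ends_tr(1)[of "Cyl \<odot> a" "u \<bullet> (\<Gamma>ul \<lhd> a)"] a u by (simp add: G_def)
  have e1G: "(e1 \<lhd> ?b) \<bullet> G = y \<bullet> (p \<lhd> a)"
    using ends_tr(2)[of "Cyl \<odot> a" "u \<bullet> (\<Gamma>ul \<lhd> a)"] a u by (simp add: G_def yp)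
  obtain M where M: "arr M" "src2 C M = S \<odot> a" "trg2 C M = coCyl \<odot> ?b"
    "M \<bullet> (r0 \<lhd> a) = G" "M \<bullet> (r1 \<lhd> a) = G \<bullet> (v \<lhd> a)"
    "M \<bullet> (s \<lhd> a) \<bullet> (i0 \<lhd> a) = (G \<bullet> (v \<lhd> a)) \<bullet> (i0 \<lhd> a)"
    "M \<bullet> (s \<lhd> a) \<bullet> (i1 \<lhd> a) = G \<bullet> (i1 \<lhd> a)"
    by (rule S_concatenation[of a "G \<bullet> (v \<lhd> a)" G]) (use a G in simp_all)
  have e0M: "(e0 \<lhd> ?b) \<bullet> M = z"
    by (rule S_ext[of a])
      (use a u z M G comp_eq_comp[OF e0G, of "v \<lhd> a"] e0G in simp_all)
  have "((e1 \<lhd> ?b) \<bullet> M) \<bullet> (s \<lhd> src2 C y) = y \<bullet> (p \<lhd> src2 C y)"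
    by (rule concatenation_constant)
      (use a u y_arr M G e1G comp_eq_comp[OF e1G, of "v \<lhd> a"] in simp_all)
  then show thesis
    using that[of "M \<bullet> (s \<lhd> a)"] a u y_arr M G G_end e0M
      comp_eq_comp[OF e0M, of "s \<lhd> a"] by simp
qed

section \<open>Trivial fibrations\<close>

lemma fibration_lift:
  assumes "fibration C T A coCyl e0 a b f" "arr g" "arr h" "src2 C g = src2 C h"
    "trg2 C g = a" "trg2 C h = coCyl \<odot> b" "(e0 \<lhd> b) \<bullet> h = f \<bullet> g"
  obtains k where "arr k" "src2 C k = src2 C h" "trg2 C k = coCyl \<odot> a"
    "(coCyl \<rhd> f) \<bullet> k = h" "(e0 \<lhd> a) \<bullet> k = g"
proof -
  have "g \<in> arrows (src2 C h) a" "h \<in> arrows (src2 C h) (coCyl \<odot> b)"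
    using assms by (simp_all add: arrows_iff)
  moreover have "src2 C h \<in> Ob (hom_cat C T A)"
    using assms(3) by (simp add: obj_Ob)
  ultimately obtain k where "k \<in> arrows (src2 C h) (coCyl \<odot> a)"
    "(coCyl \<rhd> f) \<bullet> k = h" "(e0 \<lhd> a) \<bullet> k = g"
    using assms(1,7) unfolding fibration_def by blast
  then show thesis
    using that unfolding arrows_iff by blast
qed

text \<open>Lift \<open>h\<close> starting at \<open>g\<close>: by naturality of \<open>e1\<close>, the composite of \<open>f\<close> with the end of the
  lifting is the end of \<open>h\<close>, the identity.\<close>

lemma fibration_section:
  assumes f: "fibration C T A coCyl e0 a b f" and g: "g \<in> arrows b a"
    and h: "homotopy C T A coCyl e0 e1 b b (f \<bullet> g) (id2 C b) h"
  obtains j k where "j \<in> arrows b a" "f \<bullet> j = id2 C b"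
    "homotopy C T A coCyl e0 e1 b a g j k"
proof -
  have ob: "obj a" "obj b" and f': "arr f" "src2 C f = a" "trg2 C f = b"
    using f g hom2_hom1[of g T A b a] by (auto simp: fibration_def arrows_iff)
  have h': "arr h" "src2 C h = b" "trg2 C h = coCyl \<odot> b"
    "(e0 \<lhd> b) \<bullet> h = f \<bullet> g" "(e1 \<lhd> b) \<bullet> h = id2 C b"
    using h by (simp_all add: homotopy_def arrows_iff)
  have g': "arr g" "src2 C g = b" "trg2 C g = a"
    using g by (simp_all add: arrows_iff)
  obtain k where k: "arr k" "src2 C k = b" "trg2 C k = coCyl \<odot> a"
    "(coCyl \<rhd> f) \<bullet> k = h" "(e0 \<lhd> a) \<bullet> k = g"
    using fibration_lift[OF f g'(1) h'(1)] g' h' by auto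
  have "f \<bullet> (e1 \<lhd> a) \<bullet> k = id2 C b"
    using comp_eq_comp[OF evaluation_naturality(2)[OF f'(1), symmetric], of k] ob f' h' k by simp
  then show thesis
    using that[of "(e1 \<lhd> a) \<bullet> k" k] ob k g' by (simp add: homotopy_def arrows_iff)
qed

lemma homotopy_zigzag:
  assumes h: "homotopy C T A coCyl e0 e1 a b g g0 h" and k: "homotopy C T A coCyl e0 e1 a b g g1 k"
  obtains l where "arr l" "src2 C l = Cyl \<odot> a" "trg2 C l = b"
    "l \<bullet> (i0 \<lhd> a) = g0" "l \<bullet> (i1 \<lhd> a) = g1"
proof -
  have ob: "obj a" "obj b"
    using h hom2_hom1[of g T A a b] by (auto simp: homotopy_def)
  have cylindrical: "\<exists>x. arr x \<and> src2 C x = Cyl \<odot> a \<and> trg2 C x = b \<and> x \<bullet> (i0 \<lhd> a) = g \<and>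
      x \<bullet> (i1 \<lhd> a) = g'" if m: "homotopy C T A coCyl e0 e1 a b g g' m" for g' m
  proof -
    have m': "arr m" "src2 C m = a" "trg2 C m = coCyl \<odot> b"
      "(e0 \<lhd> b) \<bullet> m = g" "(e1 \<lhd> b) \<bullet> m = g'"
      using m by (simp_all add: homotopy_def arrows_iff)
    obtain x where x: "arr x" "src2 C x = Cyl \<odot> a" "trg2 C x = b" "tr a x = m"
      using tr_surj[OF m'(1) ob(2) m'(3)] m'(2) by auto
    then have "x \<bullet> (i0 \<lhd> a) = g" "x \<bullet> (i1 \<lhd> a) = g'"
      using ends_tr[of a x] m' ob by simp_all
    with x show ?thesis by blast
  qed
  obtain x where x: "arr x" "src2 C x = Cyl \<odot> a" "trg2 C x = b" "x \<bullet> (i0 \<lhd> a) = g"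
    "x \<bullet> (i1 \<lhd> a) = g0"
    using cylindrical[OF h] by blast
  obtain y where y: "arr y" "src2 C y = Cyl \<odot> a" "trg2 C y = b" "y \<bullet> (i0 \<lhd> a) = g"
    "y \<bullet> (i1 \<lhd> a) = g1"
    using cylindrical[OF k] by blast
  obtain z where z: "arr z" "src2 C z = S \<odot> a" "trg2 C z = b"
    "z \<bullet> (s \<lhd> a) \<bullet> (i0 \<lhd> a) = g0" "z \<bullet> (s \<lhd> a) \<bullet> (i1 \<lhd> a) = g1"
    by (rule S_concatenation[of a "x \<bullet> (v \<lhd> a)" y]) (use ob x y in simp_all)
  show thesis
    by (rule that[of "z \<bullet> (s \<lhd> a)"]) (use ob z in simp_all)
qed

text \<open>Replacing \<open>l\<close> by the reverse of \<open>j f l\<close> followed by \<open>l\<close> turns the loop \<open>f l\<close> into a contractible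
  one; the lifted contraction is a square whose three remaining sides lie over the constant
  homotopy at \<open>f\<close>.\<close>

lemma fibrewise_homotopy_of_section:
  assumes f: "fibration C T A coCyl e0 a b f" and j: "j \<in> arrows b a" "f \<bullet> j = id2 C b"
    and l: "arr l" "src2 C l = Cyl \<odot> a" "trg2 C l = a"
      "l \<bullet> (i0 \<lhd> a) = j \<bullet> f" "l \<bullet> (i1 \<lhd> a) = id2 C a"
  shows "fibrewise_homotopic f f (j \<bullet> f) (id2 C a)"
proof -
  have ob: "obj a" "obj b" and f': "arr f" "src2 C f = a" "trg2 C f = b"
    using f j(1) hom2_hom1[of j T A b a] by (auto simp: fibration_def arrows_iff)
  have j': "arr j" "src2 C j = b" "trg2 C j = a"
    using j(1) by (simp_all add: arrows_iff)
  have fj: "f \<bullet> j \<bullet> w = w" if "arr w" "trg2 C w = b" for w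
    using comp_eq_comp[OF j(2), of w] f' j' that by simp
  have lv: "l \<bullet> (v \<lhd> a) \<bullet> (i0 \<lhd> a) = id2 C a" "l \<bullet> (v \<lhd> a) \<bullet> (i1 \<lhd> a) = j \<bullet> f"
    using ob l by simp_all
  obtain z where z: "arr z" "src2 C z = S \<odot> a" "trg2 C z = a"
    "z \<bullet> (r0 \<lhd> a) = l" "z \<bullet> (r1 \<lhd> a) = j \<bullet> f \<bullet> l \<bullet> (v \<lhd> a)"
    "z \<bullet> (s \<lhd> a) \<bullet> (i0 \<lhd> a) = j \<bullet> f" "z \<bullet> (s \<lhd> a) \<bullet> (i1 \<lhd> a) = id2 C a"
    by (rule S_concatenation[of a "j \<bullet> f \<bullet> l \<bullet> (v \<lhd> a)" l])
      (use ob f' j' l fj lv in simp_all)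
  have ends: "f = (f \<bullet> l) \<bullet> (i1 \<lhd> a)"
    using ob f' l by simp
  obtain h where h: "arr h" "src2 C h = Cyl \<odot> a" "trg2 C h = coCyl \<odot> b"
    "(e0 \<lhd> b) \<bullet> h = f \<bullet> z \<bullet> (s \<lhd> a)" "(e1 \<lhd> b) \<bullet> h = f \<bullet> (p \<lhd> a)"
    "h \<bullet> (i0 \<lhd> a) = (c \<lhd> b) \<bullet> f" "h \<bullet> (i1 \<lhd> a) = (c \<lhd> b) \<bullet> f"
    by (rule retraced_path_contraction[OF ob(1) _ _ _ _ _ _ _ ends, of "f \<bullet> z"])
      (use ob f' j' l z fj in simp_all)
  obtain k where k: "arr k" "src2 C k = Cyl \<odot> a" "trg2 C k = coCyl \<odot> a"
    "(coCyl \<rhd> f) \<bullet> k = h" "(e0 \<lhd> a) \<bullet> k = z \<bullet> (s \<lhd> a)"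
    by (rule fibration_lift[OF f, of "z \<bullet> (s \<lhd> a)" h]) (use ob z h in simp_all)
  \<comment> \<open>The corners of the lifted square opposite to the bottom side \<open>z \<bullet> (s \<lhd> a)\<close>.\<close>
  let ?g = "\<lambda>i. (e1 \<lhd> a) \<bullet> k \<bullet> (i \<lhd> a)"
  have side: "fibrewise_homotopic f f (z \<bullet> (s \<lhd> a) \<bullet> (i \<lhd> a)) (?g i)"
    if i: "arr (i \<lhd> a)" "src2 C (i \<lhd> a) = a" "trg2 C (i \<lhd> a) = Cyl \<odot> a"
      "h \<bullet> (i \<lhd> a) = (c \<lhd> b) \<bullet> f" for i
    using fibrewise_homotopic_iff_path[of f f] ob f' k i z
      comp_eq_comp[OF k(4), of "i \<lhd> a"] comp_eq_comp[OF k(5), of "i \<lhd> a"]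
    by (auto intro!: exI[of _ "k \<bullet> (i \<lhd> a)"])
  have top: "fibrewise_homotopic f f (?g i0) (?g i1)"
  proof -
    have "f \<bullet> (e1 \<lhd> a) \<bullet> k = f \<bullet> (p \<lhd> a)"
      using comp_eq_comp[OF evaluation_naturality(2)[OF f'(1), symmetric], of k] ob f' h k
      by simp
    then show ?thesis
      unfolding fibrewise_homotopic_def using ob f' k
      by (intro exI[of _ "(e1 \<lhd> a) \<bullet> k"]) simp
  qed
  have "fibrewise_homotopic f f (j \<bullet> f) (?g i0)" "fibrewise_homotopic f f (id2 C a) (?g i1)"
    using side[of i0] side[of i1] ob h z by simp_all
  then show ?thesis
    using top fibrewise_homotopic_sym fibrewise_homotopic_trans f'(1) by metis
qed

text \<open>Composing the homotopy from \<open>g\<close> to \<open>j\<close> with \<open>f\<close> gives the leg \<open>k f\<close> of the zigzag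
  between \<open>j f\<close> and \<open>id\<close> through \<open>g f\<close>.\<close>

theorem trivial_fibration_strong_deformation_retraction:
  assumes "trivial_fibration C T A coCyl e0 e1 a b f"
  obtains j where "j \<in> arrows b a" "strong_deformation_retraction C T A coCyl e0 e1 c b a j f"
proof -
  have f: "fibration C T A coCyl e0 a b f" "f \<in> arrows a b"
    using assms by (auto simp: trivial_fibration_def fibration_def)
  then have ob: "obj a" "obj b" and f': "arr f" "src2 C f = a" "trg2 C f = b"
    using hom2_hom1[of f T A a b] by (auto simp: arrows_iff)
  obtain g h h' where g: "g \<in> arrows b a"
    and h: "homotopy C T A coCyl e0 e1 a a (g \<bullet> f) (id2 C a) h"
    and h': "homotopy C T A coCyl e0 e1 b b (f \<bullet> g) (id2 C b) h'"
    using assms unfolding trivial_fibration_def homotopy_equivalence_def by blast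
  obtain j k where j: "j \<in> arrows b a" "f \<bullet> j = id2 C b"
    and k: "homotopy C T A coCyl e0 e1 b a g j k"
    by (rule fibration_section[OF f(1) g h'])
  have "homotopy C T A coCyl e0 e1 a a (g \<bullet> f) (j \<bullet> f) (k \<bullet> f)"
    using k f' ob comp_assoc[of f k "e0 \<lhd> a"] comp_assoc[of f k "e1 \<lhd> a"]
    by (auto simp: homotopy_def arrows_iff)
  from homotopy_zigzag[OF this h] obtain l where l: "arr l" "src2 C l = Cyl \<odot> a" "trg2 C l = a"
    "l \<bullet> (i0 \<lhd> a) = j \<bullet> f" "l \<bullet> (i1 \<lhd> a) = id2 C a" .
  from fibrewise_homotopy_of_section[OF f(1) j l]
  obtain m where "arr m" "src2 C m = a" "trg2 C m = coCyl \<odot> a"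
    "(e0 \<lhd> a) \<bullet> m = j \<bullet> f" "(e1 \<lhd> a) \<bullet> m = id2 C a" "(coCyl \<rhd> f) \<bullet> m = (c \<lhd> b) \<bullet> f"
    using fibrewise_homotopic_iff_path[of f f] f' by auto
  then have "homotopy C T A coCyl e0 e1 a a (j \<bullet> f) (id2 C a) m"
    using j f' ob by (simp add: homotopy_def arrows_iff)
  then show thesis
    using that[OF j(1)] j f(2) \<open>(coCyl \<rhd> f) \<bullet> m = (c \<lhd> b) \<bullet> f\<close>
    unfolding strong_deformation_retraction_def by blast
qed

end

theorem mainTheorem9:
  fixes C :: "('o, 'm, 'c) two_cat" and T A :: 'o
    and Cyl S coCyl :: 'm
    and i0 i1 p v r0 r1 s \<Gamma>ul e0 e1 c \<eta> \<epsilon> :: 'c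
    and a0 a1 :: 'm and f :: 'c
  assumes "formal_category C T A"
    and "cylinder C A Cyl i0 i1"
    and "contraction C A Cyl i0 i1 p"
    and "involution C A Cyl i0 i1 v"
    and "involution_compatible C p v"
    and "subdivision C A Cyl i0 i1 S r0 r1 s"
    and "subdivision_compatible C A p S r0 r1 s"
    and "upper_left_connection C A Cyl i0 i1 p \<Gamma>ul"
    and "cocylinder C A coCyl e0 e1"
    and "cocontraction C A coCyl e0 e1 c"
    and "cyl_left_adjoint C T A Cyl i0 i1 coCyl e0 e1 \<eta> \<epsilon>"
    and "adjunction_compatible C T A coCyl \<eta> p c"
    and "a0 \<in> Ob (hom_cat C T A)" and "a1 \<in> Ob (hom_cat C T A)"
    and "f \<in> hom (hom_cat C T A) a0 a1"
    and "trivial_fibration C T A coCyl e0 e1 a0 a1 f"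
  shows "\<exists>j \<in> hom (hom_cat C T A) a1 a0.
    strong_deformation_retraction C T A coCyl e0 e1 c a1 a0 j f"
proof -
  interpret adjoint_cylinder C T A Cyl S coCyl i0 i1 p v r0 r1 s \<Gamma>ul e0 e1 c \<eta> \<epsilon>
    by (intro adjoint_cylinder.intro adjoint_cylinder_axioms.intro assms)
  show ?thesis
    using trivial_fibration_strong_deformation_retraction[OF assms(16)] by blast
qed

end
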